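(* Let $L\in\{A_1,A_2,D_4,E_8\}$, $m:=\dim L$, and $n_L:=\min(N(L)\setminus\{1\})$ where $N(L):=\{\|z\|_2^m:z\in\overline{L}\setminus\{0\}\}$. Then the lattice code in $\mathbb{R}^m/L$ of size $n_L$ is optimal and unique up to isometry (every optimal code of size $n_L$ in $\mathbb{R}^m/L$ is its image under an isometry of $\mathbb{R}^m/L$), and every optimal code of size $n_L-1$ is, up to an isometry of $\mathbb{R}^m/L$, a subset of this lattice code.
   Context: $A_n$ is the set of points of $\mathbb{Z}^{n+1}$ with coordinate sum zero, viewed as a lattice in the hyperplane $\{\sum_ix_i=0\}\cong\mathbb{R}^n$; $D_4$ is the set of points of $\mathbb{Z}^4$ with even coordinate sum; $E_8$ is the set of points of $\mathbb{Z}^8\cup(\mathbb{Z}+\tfrac12)^8$ with even coordinate sum. $\ell(L)$ is the minimal norm of a nonzero lattice vector and $\overline{L}:=\ell(L)^{-1}L$. The torus $\mathbb{R}^m/L$ has metric $d(x,y):=\min\{\|s-t\|_2:s\in x,t\in y\}$; an optimal code of size $n$ is an $n$-element subset maximizing the minimum pairwise distance. $\operatorname{CO}(m):=\{cQ:c>0,Q\in\operatorname{O}(m)\}$; a lattice code is a set $(TL)/L$ with $T\in\operatorname{CO}(m)$ and $L\subseteq TL$, of size $|TL:L|$. (Lattice codes of size $n_L$ exist.) *)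

theory Defs
  imports "HOL-Analysis.Analysis"
begin

text \<open>Coordinates of vectors in real^8, indexed by natural numbers 0..7
  (the index type 8 is a ring; of_nat is a bijection from 0..7 onto it).\<close>
definition coord :: "real^8 \<Rightarrow> nat \<Rightarrow> real" where
  "coord x k = x $ (of_nat k)"

text \<open>The root lattices, embedded in real^8 by padding with zero coordinates.
  A_n (n \<le> 7): integer points of Z^(n+1) (coordinates 0..n) with coordinate sum zero.\<close>
definition A_lattice :: "nat \<Rightarrow> (real^8) set" where
  "A_lattice n = {x. (\<forall>k<8. coord x k \<in> \<int>) \<and> (\<forall>k. n < k \<and> k < 8 \<longrightarrow> coord x k = 0)
                    \<and> (\<Sum>k\<le>n. coord x k) = 0}"

definition D4_lattice :: "(real^8) set" where
  "D4_lattice = {x. (\<forall>k<8. coord x k \<in> \<int>) \<and> (\<forall>k. 4 \<le> k \<and> k < 8 \<longrightarrow> coord x k = 0)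
                    \<and> (\<exists>j::int. (\<Sum>k<4. coord x k) = of_int (2 * j))}"

definition E8_lattice :: "(real^8) set" where
  "E8_lattice = {x. ((\<forall>k<8. coord x k \<in> \<int>) \<or> (\<forall>k<8. coord x k - 1/2 \<in> \<int>))
                    \<and> (\<exists>j::int. (\<Sum>k<8. coord x k) = of_int (2 * j))}"

text \<open>General notions for a lattice L in a Euclidean space; the ambient space of the
  torus is span L (of dimension dim L = m).\<close>

definition min_norm :: "'a::euclidean_space set \<Rightarrow> real" where
  "min_norm L = Inf {norm z | z. z \<in> L \<and> z \<noteq> 0}"

definition normalized_lattice :: "'a::euclidean_space set \<Rightarrow> 'a set" where
  "normalized_lattice L = (\<lambda>z. inverse (min_norm L) *\<^sub>R z) ` L"

definition norm_powers :: "'a::euclidean_space set \<Rightarrow> real set" where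
  "norm_powers L = {norm z ^ dim L | z. z \<in> normalized_lattice L \<and> z \<noteq> 0}"

definition n_L :: "'a::euclidean_space set \<Rightarrow> real" where
  "n_L L = Inf (norm_powers L - {1})"

definition tcoset :: "'a::euclidean_space set \<Rightarrow> 'a \<Rightarrow> 'a set" where
  "tcoset L x = (\<lambda>l. x + l) ` L"

definition torus :: "'a::euclidean_space set \<Rightarrow> 'a set set" where
  "torus L = tcoset L ` span L"

definition tdist :: "'a::euclidean_space set \<Rightarrow> 'a set \<Rightarrow> 'a set \<Rightarrow> real" where
  "tdist L p q = Inf {norm (s - t) | s t. s \<in> p \<and> t \<in> q}"

definition min_dist :: "'a::euclidean_space set \<Rightarrow> 'a set set \<Rightarrow> real" where
  "min_dist L C = Inf {tdist L p q | p q. p \<in> C \<and> q \<in> C \<and> p \<noteq> q}"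

definition is_code :: "'a::euclidean_space set \<Rightarrow> nat \<Rightarrow> 'a set set \<Rightarrow> bool" where
  "is_code L n C \<longleftrightarrow> C \<subseteq> torus L \<and> finite C \<and> card C = n"

definition optimal_code :: "'a::euclidean_space set \<Rightarrow> nat \<Rightarrow> 'a set set \<Rightarrow> bool" where
  "optimal_code L n C \<longleftrightarrow> is_code L n C \<and>
     (\<forall>C'. is_code L n C' \<longrightarrow> min_dist L C' \<le> min_dist L C)"

definition conformal_on :: "'a::euclidean_space set \<Rightarrow> ('a \<Rightarrow> 'a) \<Rightarrow> bool" where
  "conformal_on L T \<longleftrightarrow> linear T \<and> T ` span L \<subseteq> span L \<and>
     (\<exists>c>0. \<forall>x\<in>span L. norm (T x) = c * norm x)"

definition lattice_code :: "'a::euclidean_space set \<Rightarrow> 'a set set \<Rightarrow> bool" where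
  "lattice_code L C \<longleftrightarrow> (\<exists>T. conformal_on L T \<and> L \<subseteq> T ` L \<and> C = tcoset L ` (T ` L))"

definition torus_isometry :: "'a::euclidean_space set \<Rightarrow> ('a set \<Rightarrow> 'a set) \<Rightarrow> bool" where
  "torus_isometry L \<phi> \<longleftrightarrow> bij_betw \<phi> (torus L) (torus L) \<and>
     (\<forall>p\<in>torus L. \<forall>q\<in>torus L. tdist L (\<phi> p) (\<phi> q) = tdist L p q)"

end

theory Submission
  imports Defs
begin

text \<open>
  Let \<open>R\<close> be the covering radius of \<open>L\<close>, so that no two points of the torus are further than \<open>R\<close>
  apart. The lattice code of size \<open>n_L\<close> has all its distances equal to \<open>R\<close>; hence an optimal code of
  size \<open>n_L\<close> or \<open>n_L - 1\<close> is a set whose differences are all deep holes. For \<open>A_1\<close>, \<open>A_2\<close>,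
  \<open>D_4\<close> there are only \<open>n_L - 1\<close> deep holes modulo \<open>L\<close>, so a translation suffices. For \<open>E_8\<close> the deep
  holes are halves of lattice vectors of squared norm 4: a code through the origin is a set of pairwise
  orthogonal singular vectors of the quadratic space \<open>E_8 / 2 E_8\<close>, and has at most 16 elements. If
  \<open>C\<close> is such a set with 16 elements and \<open>w \<notin> C\<close> lies in another such set \<open>C'\<close>, then some
  \<open>u \<in> C\<close> is not orthogonal to \<open>w\<close>, the class of \<open>u - w\<close> contains a root, and the reflection in this
  root moves \<open>u\<close> to \<open>w\<close> while fixing \<open>C \<inter> C'\<close>; iterating, \<open>C\<close> is moved to a set containing \<open>C'\<close>.
\<close>

section \<open>Codes in a torus\<close>

text \<open>The four lattices share a coincidence: with minimal squared norm 2, the squared covering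
  radius \<open>\<rho>\<close> and the second smallest squared norm \<open>\<sigma>\<close> satisfy
  \<open>\<rho> * \<sigma> = 4\<close> (1/2 and 8, 2/3 and 6, 1 and 4, 1 and 4). Hence a similarity
  of ratio sqrt (\<rho> / 2) gives a superlattice whose minimal norm is the covering radius, and by
  volume its index is (\<sigma> / 2)^(m/2), that is \<open>n_L\<close>. The obstacle is that the
  theorem speaks of every lattice code of that size, while no determinant or index is computed here.
  Two counting arguments replace the volume: \<open>n_L\<close> + 1 lattice points with mutual
  squared distances at most \<open>\<sigma>\<close> bound the ratio of an arbitrary code from below
  by the pigeonhole principle, and for one explicit similarity the index is squeezed between the
  bound for separated sets and a set of \<open>n_L\<close> inequivalent points. Optimality,
  uniqueness and the statement on \<open>n_L\<close> - 1 points all rest on one embedding property,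
  in which the set to be embedded may have any size.\<close>

definition separated :: "'a::euclidean_space set \<Rightarrow> real \<Rightarrow> 'a set set \<Rightarrow> bool" where
  "separated L R C \<longleftrightarrow> C \<subseteq> torus L \<and> (\<forall>p\<in>C. \<forall>q\<in>C. p \<noteq> q \<longrightarrow> R \<le> tdist L p q)"

definition lattice_code_optimal_unique :: "'a::euclidean_space set \<Rightarrow> bool" where
  "lattice_code_optimal_unique L \<longleftrightarrow>
     (\<exists>C. lattice_code L C \<and> finite C \<and> real (card C) = n_L L) \<and>
     (\<forall>C. lattice_code L C \<and> finite C \<and> real (card C) = n_L L \<longrightarrow>
          optimal_code L (card C) C \<and>
          (\<forall>C'. optimal_code L (card C) C' \<longrightarrow>
                (\<exists>\<phi>. torus_isometry L \<phi> \<and> C' = \<phi> ` C)) \<and>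
          (\<forall>C'. optimal_code L (card C - 1) C' \<longrightarrow>
                (\<exists>\<phi>. torus_isometry L \<phi> \<and> C' \<subseteq> \<phi> ` C)))"

text \<open>A point of the torus is a set of representatives, so a Euclidean isometry acts on it by
  taking images; \<open>tdist\<close> is computed from all representatives and is therefore
  unchanged.\<close>

lemma torus_isometryI:
  assumes norm: "\<And>x y. norm (f x - f y) = norm (x - y :: 'a::euclidean_space)"
    and coset: "\<And>x. x \<in> span L \<Longrightarrow> f ` tcoset L x = tcoset L (f x)"
    and span: "f ` span L = span L"
  shows "torus_isometry L ((`) f)"
proof -
  have "inj f"
    by (rule injI) (metis eq_iff_diff_eq_0 norm norm_eq_zero)
  then have "inj_on ((`) f) (torus L)"
    by (meson inj_image_eq_iff inj_onI)
  moreover have "(`) f ` torus L = tcoset L ` (f ` span L)"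
    unfolding torus_def image_image using coset by (auto intro!: image_cong)
  ultimately have "bij_betw ((`) f) (torus L) (torus L)"
    unfolding bij_betw_def span by (simp add: torus_def)
  moreover have "tdist L (f ` p) (f ` q) = tdist L p q" for p q
  proof -
    have "{norm (s - t) |s t. s \<in> f ` p \<and> t \<in> f ` q} = {norm (s - t) |s t. s \<in> p \<and> t \<in> q}"
    proof safe
      fix s t assume "s \<in> p" "t \<in> q"
      then show "\<exists>s' t'. norm (f s - f t) = norm (s' - t') \<and> s' \<in> p \<and> t' \<in> q"
        and "\<exists>s' t'. norm (s - t) = norm (s' - t') \<and> s' \<in> f ` p \<and> t' \<in> f ` q"
        using norm by (metis, metis imageI)
    qed
    then show ?thesis by (simp add: tdist_def)
  qed
  ultimately show ?thesis by (simp add: torus_isometry_def)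
qed

lemma torus_isometry_comp:
  assumes "torus_isometry L \<phi>" "torus_isometry L \<psi>"
  shows "torus_isometry L (\<phi> \<circ> \<psi>)"
proof -
  have "bij_betw (\<phi> \<circ> \<psi>) (torus L) (torus L)"
    using assms by (meson bij_betw_trans torus_isometry_def)
  moreover have "\<psi> p \<in> torus L" if "p \<in> torus L" for p
    using assms(2) that unfolding torus_isometry_def by (meson bij_betw_apply)
  ultimately show ?thesis using assms by (simp add: torus_isometry_def)
qed

lemma torus_isometry_id: "torus_isometry L id"
  by (simp add: torus_isometry_def)

lemma separated_isometry:
  assumes "torus_isometry L \<phi>" "separated L R C"
  shows "separated L R (\<phi> ` C)"
  unfolding separated_def
proof (intro conjI ballI impI)
  have sub: "C \<subseteq> torus L" and bij: "bij_betw \<phi> (torus L) (torus L)"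
    using assms by (simp_all add: separated_def torus_isometry_def)
  then show "\<phi> ` C \<subseteq> torus L" by (metis bij_betw_imp_surj_on image_mono)
  fix p q assume "p \<in> \<phi> ` C" "q \<in> \<phi> ` C" "p \<noteq> q"
  then obtain p' q' where "p' \<in> C" "q' \<in> C" "p' \<noteq> q'" "p = \<phi> p'" "q = \<phi> q'" by blast
  then show "R \<le> tdist L p q"
    using assms sub by (metis separated_def subsetD torus_isometry_def)
qed

lemma separated_subset: "separated L R C \<Longrightarrow> D \<subseteq> C \<Longrightarrow> separated L R D"
  by (simp add: separated_def subset_iff)

lemma tdist_commute: "tdist L p q = tdist L q p"
proof -
  have "{norm (s - t) |s t. s \<in> p \<and> t \<in> q} = {norm (s - t) |s t. s \<in> q \<and> t \<in> p}"
    using norm_minus_commute by metis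
  then show ?thesis by (simp add: tdist_def)
qed

lemma separated_insert:
  assumes C: "separated L R C" and p: "p \<in> torus L" and dist: "\<And>q. q \<in> C \<Longrightarrow> R \<le> tdist L q p"
  shows "separated L R (insert p C)"
  unfolding separated_def
proof (intro conjI ballI impI)
  show "insert p C \<subseteq> torus L" using C p by (simp add: separated_def)
  fix a b assume ab: "a \<in> insert p C" "b \<in> insert p C" "a \<noteq> b"
  show "R \<le> tdist L a b"
  proof (cases "a = p \<or> b = p")
    case True
    then show ?thesis using ab dist[of a] dist[of b] tdist_commute[of L] by force
  next
    case False
    then show ?thesis using ab C by (simp add: separated_def)
  qed
qed

section \<open>Cosets, translations and deep holes\<close>

locale additive_lattice =
  fixes L :: "'a::euclidean_space set"
  assumes zero_mem: "0 \<in> L" and diff_mem: "\<And>x y. x \<in> L \<Longrightarrow> y \<in> L \<Longrightarrow> x - y \<in> L"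
begin

lemma uminus_mem: "x \<in> L \<Longrightarrow> - x \<in> L"
  using diff_mem[OF zero_mem, of x] by simp

lemma add_mem: "x \<in> L \<Longrightarrow> y \<in> L \<Longrightarrow> x + y \<in> L"
  using diff_mem[of x "- y"] uminus_mem by simp

lemma scale_int_mem: "x \<in> L \<Longrightarrow> k \<in> \<int> \<Longrightarrow> k *\<^sub>R x \<in> L"
proof -
  assume x: "x \<in> L" and "k \<in> \<int>"
  then obtain i where k: "k = of_int i" by (auto elim: Ints_cases)
  have nat: "real n *\<^sub>R x \<in> L" for n
    by (induction n) (auto simp: zero_mem scaleR_add_left intro: add_mem x)
  show ?thesis
    using nat[of "nat i"] uminus_mem[OF nat[of "nat (- i)"]] by (cases "0 \<le> i") (auto simp: k)
qed

lemma mem_tcoset: "y \<in> tcoset L x \<longleftrightarrow> y - x \<in> L"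
  by (auto simp: tcoset_def image_iff) (metis add.commute diff_add_cancel)

lemma self_mem_tcoset: "x \<in> tcoset L x"
  by (simp add: mem_tcoset zero_mem)

lemma tcoset_eq_iff: "tcoset L x = tcoset L y \<longleftrightarrow> x - y \<in> L"
proof
  assume "tcoset L x = tcoset L y"
  then show "x - y \<in> L" using self_mem_tcoset[of x] by (simp add: mem_tcoset)
next
  assume xy: "x - y \<in> L"
  have "z - x \<in> L \<longleftrightarrow> z - y \<in> L" for z
    using add_mem[OF _ xy, of "z - x"] diff_mem[OF _ xy, of "z - y"] by auto
  then show "tcoset L x = tcoset L y" by (auto simp: mem_tcoset)
qed

lemma tdist_tcoset:
  "tdist L (tcoset L x) (tcoset L y) = Inf {norm (x - y - l) |l. l \<in> L}"
proof -
  have "{norm (s - t) |s t. s \<in> tcoset L x \<and> t \<in> tcoset L y} = {norm (x - y - l) |l. l \<in> L}"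
  proof safe
    fix s t assume "s \<in> tcoset L x" "t \<in> tcoset L y"
    then have "(t - y) - (s - x) \<in> L" by (auto simp: mem_tcoset intro: diff_mem)
    then show "\<exists>l. norm (s - t) = norm (x - y - l) \<and> l \<in> L"
      by (intro exI[of _ "(t - y) - (s - x)"]) (simp add: algebra_simps)
  next
    fix l assume "l \<in> L"
    then show "\<exists>s t. norm (x - y - l) = norm (s - t) \<and> s \<in> tcoset L x \<and> t \<in> tcoset L y"
      by (intro exI[of _ x] exI[of _ "y + l"]) (auto simp: mem_tcoset zero_mem algebra_simps)
  qed
  then show ?thesis by (simp add: tdist_def)
qed

text \<open>A lower bound of an infimum is checked vector by vector, so no closest representatives
  have to be produced. Later proofs reach \<open>tdist\<close> through this form.\<close>

lemma le_tdist_iff: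
  "R \<le> tdist L (tcoset L x) (tcoset L y) \<longleftrightarrow> (\<forall>l\<in>L. R \<le> norm (x - y - l))"
proof -
  have "bdd_below {norm (x - y - l) |l. l \<in> L}" by (rule bdd_belowI[of _ 0]) auto
  then show ?thesis
    unfolding tdist_tcoset using zero_mem by (subst le_cInf_iff) auto
qed

lemma tdist_nonneg: "p \<in> torus L \<Longrightarrow> q \<in> torus L \<Longrightarrow> 0 \<le> tdist L p q"
  by (auto simp: torus_def le_tdist_iff)

lemma translation_isometry:
  assumes "c \<in> span L"
  shows "torus_isometry L ((`) ((+) c))"
proof (rule torus_isometryI)
  show "(+) c ` tcoset L x = tcoset L (c + x)" for x
    by (auto simp: tcoset_def image_image algebra_simps)
  show "(+) c ` span L = span L"
  proof safe
    fix x assume "x \<in> span L" then show "c + x \<in> span L" by (simp add: assms span_add)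
  next
    fix x assume "x \<in> span L"
    then show "x \<in> (+) c ` span L"
      by (intro image_eqI[of _ _ "x - c"]) (auto simp: assms span_diff)
  qed
qed auto

lemma translate_tcoset: "(+) c ` tcoset L x = tcoset L (c + x)"
  by (auto simp: tcoset_def image_image algebra_simps)

lemma linear_isometry:
  assumes f: "linear f" "\<And>x. norm (f x) = norm x" and L: "f ` L = L"
  shows "torus_isometry L ((`) f)"
proof (rule torus_isometryI)
  show "f ` tcoset L x = tcoset L (f x)" for x
    unfolding tcoset_def image_image linear_add[OF f(1)] by (subst (2) L[symmetric]) (simp add: image_image)
  show "f ` span L = span L"
    by (metis f(1) L linear_span_image)
qed (metis f linear_diff)

text \<open>Translating a point of each set to the origin coset turns the condition on differences
  into one on the points themselves. The isometry found there is conjugated back by the two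
  translations; \<open>n \<noteq> 0\<close> supplies the point of \<open>C\<close>.\<close>

lemma separated_embedding_translate:
  assumes origin: "\<And>C C'. separated L R C \<Longrightarrow> separated L R C' \<Longrightarrow> finite C \<Longrightarrow> card C = n \<Longrightarrow>
      tcoset L 0 \<in> C \<Longrightarrow> tcoset L 0 \<in> C' \<Longrightarrow> \<exists>\<phi>. torus_isometry L \<phi> \<and> C' \<subseteq> \<phi> ` C"
    and C: "separated L R C" "finite C" "card C = n" "n \<noteq> 0" and C': "separated L R C'"
  shows "\<exists>\<phi>. torus_isometry L \<phi> \<and> C' \<subseteq> \<phi> ` C"
proof (cases "C' = {}")
  case True
  then show ?thesis using torus_isometry_id by blast
next
  case False
  then obtain c' where c': "c' \<in> span L" "tcoset L c' \<in> C'"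
    using C' by (fastforce simp: separated_def torus_def)
  have "C \<noteq> {}" using C by auto
  then obtain c where c: "c \<in> span L" "tcoset L c \<in> C"
    using C by (fastforce simp: separated_def torus_def)
  let ?t = "\<lambda>d. (`) ((+) d)"
  have iso: "torus_isometry L (?t d)" if "d \<in> span L" for d
    using that by (rule translation_isometry)
  have s: "separated L R (?t (- c) ` C)" "separated L R (?t (- c') ` C')"
    using C(1) C' separated_isometry[OF iso[OF span_neg]] c(1) c'(1) by blast+
  have "inj_on (?t (- c)) C"
    by (meson add_left_cancel inj_image_eq_iff inj_onI)
  then have card: "card (?t (- c) ` C) = n" using C by (metis card_image)
  have mem: "tcoset L 0 \<in> ?t (- c) ` C" "tcoset L 0 \<in> ?t (- c') ` C'"
    using c(2) c'(2) translate_tcoset[of "-c" c] translate_tcoset[of "-c'" c']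
    by (metis add.left_inverse imageI)+
  obtain \<phi> where \<phi>: "torus_isometry L \<phi>" "?t (- c') ` C' \<subseteq> \<phi> ` (?t (- c) ` C)"
    using origin[OF s finite_imageI[OF C(2)] card mem] by blast
  have "C' = ?t c' ` (?t (- c') ` C')"
    by (simp add: image_image)
  also have "\<dots> \<subseteq> ?t c' ` (\<phi> ` (?t (- c) ` C))"
    using \<phi>(2) by (rule image_mono)
  also have "\<dots> = (?t c' \<circ> \<phi> \<circ> ?t (- c)) ` C"
    by (simp add: image_comp comp_assoc)
  finally show ?thesis
    using \<phi>(1) c c' by (blast intro: torus_isometry_comp iso span_neg)
qed

lemma separated_subset_holes:
  assumes holes: "\<And>x. x \<in> span L \<Longrightarrow> (\<forall>l\<in>L. R \<le> norm (x - l)) \<Longrightarrow> tcoset L x \<in> D"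
    and C: "separated L R C" "tcoset L 0 \<in> C"
  shows "C \<subseteq> insert (tcoset L 0) D"
proof
  fix p assume p: "p \<in> C"
  show "p \<in> insert (tcoset L 0) D"
  proof (cases "p = tcoset L 0")
    case False
    obtain x where x: "x \<in> span L" "p = tcoset L x"
      using p C by (auto simp: separated_def torus_def)
    have "R \<le> tdist L p (tcoset L 0)" using C p False unfolding separated_def by blast
    then show ?thesis using x by (auto simp: le_tdist_iff intro!: holes)
  qed auto
qed

lemma separated_card_few_holes:
  assumes D: "finite D" "card D < n"
    and holes: "\<And>x. x \<in> span L \<Longrightarrow> (\<forall>l\<in>L. R \<le> norm (x - l)) \<Longrightarrow> tcoset L x \<in> D"
    and C: "separated L R C" "tcoset L 0 \<in> C"
  shows "finite C \<and> card C \<le> n"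
proof -
  note sub = separated_subset_holes[OF holes C]
  have "card C \<le> card (insert (tcoset L 0) D)" using sub D by (intro card_mono) auto
  also have "\<dots> \<le> n" using D by (simp add: card_insert_if)
  finally show ?thesis using sub D finite_subset by blast
qed

text \<open>With fewer than \<open>n\<close> classes in \<open>D\<close>, a set of size
  \<open>n\<close> through the origin coset must consist of that coset and all of \<open>D\<close>.
  It then contains every other separated set through the origin, and the identity suffices.\<close>

lemma separated_embedding_few_holes:
  assumes D: "finite D" "card D < n"
    and holes: "\<And>x. x \<in> span L \<Longrightarrow> (\<forall>l\<in>L. R \<le> norm (x - l)) \<Longrightarrow> tcoset L x \<in> D"
    and C: "separated L R C" "finite C" "card C = n" and C': "separated L R C'"
  shows "\<exists>\<phi>. torus_isometry L \<phi> \<and> C' \<subseteq> \<phi> ` C"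
proof (rule separated_embedding_translate[OF _ C _ C'])
  fix C C' assume C: "separated L R C" "separated L R C'" "finite C" "card C = n"
    "tcoset L 0 \<in> C" "tcoset L 0 \<in> C'"
  have "C = insert (tcoset L 0) D"
    using separated_subset_holes[OF holes C(1,5)] C D by (intro card_seteq) (auto simp: card_insert_if)
  then show "\<exists>\<phi>. torus_isometry L \<phi> \<and> C' \<subseteq> \<phi> ` C"
    using separated_subset_holes[OF holes C(2,6)] torus_isometry_id by (intro exI[of _ id]) auto
qed (use D in auto)

end

section \<open>Optimality from a covering radius and an embedding property\<close>

lemma ge_min_dist:
  assumes "\<And>p q. p \<in> C \<Longrightarrow> q \<in> C \<Longrightarrow> 0 \<le> tdist L p q" "p \<in> C" "q \<in> C" "p \<noteq> q"
  shows "min_dist L C \<le> tdist L p q"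
  unfolding min_dist_def using assms by (intro cInf_lower bdd_belowI[of _ 0]) auto

lemma min_dist_ge:
  assumes "separated L R C" "p \<in> C" "q \<in> C" "p \<noteq> q"
  shows "R \<le> min_dist L C"
  unfolding min_dist_def using assms by (intro cInf_greatest) (auto simp: separated_def)

lemma two_elements:
  assumes "finite C" "2 \<le> card C"
  obtains p q where "p \<in> C" "q \<in> C" "p \<noteq> q"
proof -
  have "\<not> card C \<le> Suc 0" using assms by simp
  then show ?thesis using assms(1) that by (meson card_le_Suc0_iff_eq)
qed

text \<open>\<open>covering\<close> bounds all distances by \<open>R\<close>, so an
  \<open>R\<close>-separated code of size \<open>n\<close> cannot be improved.
  \<open>embedding\<close> leaves the size of \<open>C'\<close> free in order to serve codes of size
  \<open>n\<close> and of size \<open>n - 1\<close> at once.\<close>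

locale tight_lattice = additive_lattice +
  fixes R :: real and n :: nat
  assumes n_ge_2: "2 \<le> n"
    and covering: "\<And>x. x \<in> span L \<Longrightarrow> \<exists>l\<in>L. norm (x - l) \<le> R"
    and embedding: "\<And>C C'. separated L R C \<Longrightarrow> finite C \<Longrightarrow> card C = n \<Longrightarrow> separated L R C' \<Longrightarrow>
      \<exists>\<phi>. torus_isometry L \<phi> \<and> C' \<subseteq> \<phi> ` C"
begin

lemma tdist_le:
  assumes "p \<in> torus L" "q \<in> torus L"
  shows "tdist L p q \<le> R"
proof -
  obtain x y where x: "x \<in> span L" "p = tcoset L x" and y: "y \<in> span L" "q = tcoset L y"
    using assms by (auto simp: torus_def)
  obtain l where "l \<in> L" "norm (x - y - l) \<le> R" using covering x y by (meson span_diff)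
  moreover have "tdist L p q \<le> norm (x - y - l)"
    using le_tdist_iff[of "tdist L p q" x y] x y \<open>l \<in> L\<close> by blast
  ultimately show ?thesis by simp
qed

text \<open>Below two points \<open>min_dist\<close> is the infimum of the empty set and carries no
  information, while separation is trivial; hence the guard \<open>2 \<le> k\<close>. For A_1 the
  codes of size \<open>n - 1\<close> are single points.\<close>

lemma separated_of_le_min_dist:
  assumes "is_code L k C" "2 \<le> k \<Longrightarrow> R \<le> min_dist L C"
  shows "separated L R C"
  unfolding separated_def
proof (intro conjI ballI impI)
  show C: "C \<subseteq> torus L" using assms by (simp add: is_code_def)
  fix p q assume pq: "p \<in> C" "q \<in> C" "p \<noteq> q"
  then have "2 \<le> k"
    using assms(1) card_le_Suc0_iff_eq[of C] by (auto simp: is_code_def not_less_eq_eq numeral_2_eq_2)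
  moreover have "min_dist L C \<le> tdist L p q"
    using pq C by (intro ge_min_dist tdist_nonneg) auto
  ultimately show "R \<le> tdist L p q" using assms(2) by simp
qed

lemma separated_optimal:
  assumes C: "separated L R C" "finite C" "card C = n"
  shows "optimal_code L n C \<and>
    (\<forall>C'. optimal_code L n C' \<longrightarrow> (\<exists>\<phi>. torus_isometry L \<phi> \<and> C' = \<phi> ` C)) \<and>
    (\<forall>C'. optimal_code L (n - 1) C' \<longrightarrow> (\<exists>\<phi>. torus_isometry L \<phi> \<and> C' \<subseteq> \<phi> ` C))"
proof (intro conjI allI impI)
  have code: "is_code L n C" using C by (auto simp: is_code_def separated_def)
  have RC: "R \<le> min_dist L C"
    using C n_ge_2 by (metis min_dist_ge two_elements)
  show "optimal_code L n C"
    unfolding optimal_code_def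
  proof (intro conjI code allI impI)
    fix C' assume C': "is_code L n C'"
    then obtain p q where pq: "p \<in> C'" "q \<in> C'" "p \<noteq> q"
      using n_ge_2 by (metis is_code_def two_elements)
    have "min_dist L C' \<le> tdist L p q"
      using C' pq by (intro ge_min_dist tdist_nonneg) (auto simp: is_code_def)
    also have "\<dots> \<le> R" using C' pq by (intro tdist_le) (auto simp: is_code_def)
    finally show "min_dist L C' \<le> min_dist L C" using RC by simp
  qed
  fix C'
  show "\<exists>\<phi>. torus_isometry L \<phi> \<and> C' = \<phi> ` C" if C': "optimal_code L n C'"
  proof -
    have "separated L R C'"
      using C' code RC by (intro separated_of_le_min_dist[of n]) (force simp: optimal_code_def)+
    then obtain \<phi> where \<phi>: "torus_isometry L \<phi>" "C' \<subseteq> \<phi> ` C" using embedding C by blast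
    moreover have "C' = \<phi> ` C"
      using \<phi>(2) C C' card_image_le[OF C(2), of \<phi>]
      by (intro card_seteq) (auto simp: optimal_code_def is_code_def)
    ultimately show ?thesis by blast
  qed
  show "\<exists>\<phi>. torus_isometry L \<phi> \<and> C' \<subseteq> \<phi> ` C" if C': "optimal_code L (n - 1) C'"
  proof -
    \<comment> \<open>Dropping any point of \<open>C\<close> gives a separated competitor of size
      \<open>n - 1\<close>, against which \<open>C'\<close> is measured.\<close>
    obtain p where p: "p \<in> C" using C n_ge_2 by fastforce
    have D: "separated L R (C - {p})" "card (C - {p}) = n - 1"
      using C p by (auto intro: separated_subset)
    then have "is_code L (n - 1) (C - {p})"
      using C by (auto simp: is_code_def separated_def)
    then have "min_dist L (C - {p}) \<le> min_dist L C'"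
      using C' by (auto simp: optimal_code_def)
    moreover have "R \<le> min_dist L (C - {p})" if "2 \<le> n - 1"
      using D C that by (metis finite_Diff min_dist_ge two_elements)
    ultimately have "separated L R C'"
      using C' by (intro separated_of_le_min_dist[of "n - 1"]) (auto simp: optimal_code_def)
    then show ?thesis using embedding C by blast
  qed
qed

end

section \<open>Lattice codes without index computations\<close>

context additive_lattice
begin

text \<open>Since \<open>L\<close> lies in its own image under \<open>T\<close>, a difference of two
  code points stays in that image after subtracting any vector of \<open>L\<close>. Distinct cosets
  make it nonzero, and nonzero vectors of the image have norm at least \<open>c * r\<close>.\<close>

lemma conformal_image_separated:
  assumes min: "\<And>z. z \<in> L \<Longrightarrow> z \<noteq> 0 \<Longrightarrow> r \<le> norm z"
    and T: "linear T" "T ` span L \<subseteq> span L" "\<And>x. x \<in> span L \<Longrightarrow> norm (T x) = c * norm x" "L \<subseteq> T ` L"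
    and c: "0 < c" "R \<le> c * r"
  shows "separated L R (tcoset L ` T ` L)"
  unfolding separated_def
proof (intro conjI ballI impI)
  show "tcoset L ` T ` L \<subseteq> torus L"
    unfolding torus_def using T(2) span_superset[of L] by blast
  fix p q assume "p \<in> tcoset L ` T ` L" "q \<in> tcoset L ` T ` L" "p \<noteq> q"
  then obtain x y where xy: "x \<in> L" "y \<in> L" "p = tcoset L (T x)" "q = tcoset L (T y)"
    "tcoset L (T x) \<noteq> tcoset L (T y)"
    by blast
  then have nmem: "T x - T y \<notin> L" by (simp add: tcoset_eq_iff)
  show "R \<le> tdist L p q"
    unfolding xy le_tdist_iff
  proof
    fix l assume l: "l \<in> L"
    then obtain z where z: "z \<in> L" "l = T z" using T by auto
    let ?z = "x - y - z"
    have Tz: "T ?z = T x - T y - l" using z T(1) by (simp add: linear_diff)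
    have mem: "?z \<in> L" using xy z diff_mem by simp
    have "?z \<noteq> 0"
    proof
      assume "?z = 0"
      then have "T x - T y = l" using Tz T(1) by (simp add: linear_0)
      then show False using l nmem by simp
    qed
    then have "c * r \<le> c * norm ?z" using min[OF mem] c by simp
    also have "\<dots> = norm (T x - T y - l)"
      using T(3)[of ?z] mem Tz by (simp add: span_base)
    finally show "R \<le> norm (T x - T y - l)" using c by simp
  qed
qed

text \<open>If the conformal factor were too small, the images of \<open>P\<close> would be closer together
  than the minimal norm of \<open>L\<close>, hence would represent too many points of the torus.\<close>

lemma lattice_code_separated:
  fixes C :: "'a set set"
  assumes min: "\<And>z. z \<in> L \<Longrightarrow> z \<noteq> 0 \<Longrightarrow> r \<le> norm z"
    and P: "P \<subseteq> L" "finite P" "card C < card P"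
    and dist: "\<And>p q. p \<in> P \<Longrightarrow> q \<in> P \<Longrightarrow> R * norm (p - q) \<le> r\<^sup>2"
    and R: "0 < R" and r: "0 < r"
    and C: "lattice_code L C" "finite C"
  shows "separated L R C"
proof -
  obtain T c where T: "linear T" "T ` span L \<subseteq> span L" "0 < c"
      "\<And>x. x \<in> span L \<Longrightarrow> norm (T x) = c * norm x" "L \<subseteq> T ` L" "C = tcoset L ` (T ` L)"
    using C(1) unfolding lattice_code_def conformal_on_def by metis
  have "\<not> inj_on (\<lambda>p. tcoset L (T p)) P"
  proof
    assume "inj_on (\<lambda>p. tcoset L (T p)) P"
    then have "card P \<le> card C"
      using P(1) C(2) T(6) by (intro card_inj_on_le[of _ P C]) auto
    then show False using P by simp
  qed
  then obtain p q where pq: "p \<in> P" "q \<in> P" "p \<noteq> q" "T p - T q \<in> L"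
    by (auto simp: inj_on_def tcoset_eq_iff)
  have "p - q \<in> span L" using pq P by (meson span_base span_diff subsetD)
  then have nTpq: "norm (T p - T q) = c * norm (p - q)"
    using T by (metis linear_diff)
  have "T p - T q \<noteq> 0" using nTpq pq T(3) by auto
  then have "r \<le> c * norm (p - q)" using min pq nTpq by metis
  \<comment> \<open>Multiplying by \<open>R\<close> brings in the bound on \<open>P\<close>, so that
    \<open>p\<close> and \<open>q\<close> drop out and only \<open>R \<le> c * r\<close>
    remains.\<close>
  then have "R * r \<le> c * (R * norm (p - q))"
    using R by (metis mult.left_commute mult_le_cancel_left_pos)
  also have "\<dots> \<le> c * r\<^sup>2" using dist pq T(3) by simp
  finally have "R \<le> c * r" using r by (simp add: power2_eq_square)
  then show ?thesis
    unfolding T(6) using T by (intro conformal_image_separated[OF min]) auto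
qed

text \<open>The size is squeezed: \<open>upper\<close> bounds separated sets through the origin
  coset, and the points of \<open>G\<close> have different images modulo \<open>L\<close>. The
  conditions on \<open>s\<close> say that a multiple of \<open>T\<close> maps \<open>L\<close> into
  itself and is a right inverse of \<open>T\<close> there, which puts \<open>L\<close> inside its
  image.\<close>

lemma exists_lattice_code:
  assumes min: "\<And>z. z \<in> L \<Longrightarrow> z \<noteq> 0 \<Longrightarrow> r \<le> norm z"
    and T: "linear T" "\<And>x. x \<in> span L \<Longrightarrow> norm (T x) = c * norm x"
    and c: "0 < c" "R \<le> c * r"
    and s: "s \<noteq> 0" "\<And>l. l \<in> L \<Longrightarrow> s *\<^sub>R T l \<in> L" "\<And>l. l \<in> L \<Longrightarrow> T (s *\<^sub>R T l) = l"
    and upper: "\<And>C. separated L R C \<Longrightarrow> tcoset L 0 \<in> C \<Longrightarrow> finite C \<and> card C \<le> n"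
    and G: "G \<subseteq> L" "card G = n" "\<And>x y. x \<in> G \<Longrightarrow> y \<in> G \<Longrightarrow> T (x - y) \<in> L \<Longrightarrow> x = y"
  shows "\<exists>C. lattice_code L C \<and> finite C \<and> card C = n"
proof (intro exI conjI)
  let ?C = "tcoset L ` T ` L"
  have "T x \<in> span L" if "x \<in> L" for x
    using span_scale[OF span_base[OF s(2)[OF that]], of "inverse s"] s(1) by simp
  then have span: "T ` span L \<subseteq> span L"
    by (simp add: linear_span_image[OF T(1), symmetric] image_subset_iff span_minimal)
  have L: "L \<subseteq> T ` L"
    using s(2,3) by (metis image_eqI subsetI)
  show "lattice_code L ?C"
    unfolding lattice_code_def conformal_on_def using T c span L by blast
  have "0 = T 0" using T(1) by (simp add: linear_0)
  then have "tcoset L 0 \<in> ?C" using zero_mem by blast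
  then have *: "finite ?C \<and> card ?C \<le> n"
    by (intro upper conformal_image_separated[OF min T(1) span T(2) L c])
  then show "finite ?C" by blast
  have "inj_on (\<lambda>x. tcoset L (T x)) G"
    using G(3) by (auto simp: inj_on_def tcoset_eq_iff linear_diff[OF T(1)])
  then have "n \<le> card ?C"
    using * G(1) unfolding G(2)[symmetric] by (intro card_inj_on_le) auto
  then show "card ?C = n" using * by simp
qed

end

lemma n_L_eqI:
  fixes L :: "'a::euclidean_space set"
  assumes min: "\<And>z. z \<in> L \<Longrightarrow> z \<noteq> 0 \<Longrightarrow> r \<le> norm z" and r: "0 < r"
    and z0: "z0 \<in> L" "norm z0 = r"
    and z1: "z1 \<in> L" "norm z1 = s" and s: "r < s"
    and second: "\<And>z. z \<in> L \<Longrightarrow> z \<noteq> 0 \<Longrightarrow> norm z \<noteq> r \<Longrightarrow> s \<le> norm z"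
    and dim: "0 < dim L"
  shows "n_L L = (s / r) ^ dim L"
proof -
  have mn: "min_norm L = r"
    unfolding min_norm_def using z0 r min
    by (intro cInf_eq_minimum) (auto intro!: exI[of _ z0])
  have np: "norm_powers L = {(norm z / r) ^ dim L |z. z \<in> L \<and> z \<noteq> 0}"
  proof (intro set_eqI iffI)
    fix t assume "t \<in> norm_powers L"
    then obtain z where z: "z \<in> L" "inverse r *\<^sub>R z \<noteq> 0" "t = norm (inverse r *\<^sub>R z) ^ dim L"
      unfolding norm_powers_def normalized_lattice_def mn by blast
    then have "z \<noteq> 0" "t = (norm z / r) ^ dim L"
      using r by (auto simp: divide_inverse mult.commute)
    then show "t \<in> {(norm z / r) ^ dim L |z. z \<in> L \<and> z \<noteq> 0}" using z by blast
  next
    fix t assume "t \<in> {(norm z / r) ^ dim L |z. z \<in> L \<and> z \<noteq> 0}"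
    then obtain z where z: "z \<in> L" "z \<noteq> 0" "t = (norm z / r) ^ dim L" by blast
    then have "inverse r *\<^sub>R z \<noteq> 0" "t = norm (inverse r *\<^sub>R z) ^ dim L"
      using r by (auto simp: divide_inverse mult.commute)
    moreover have "inverse r *\<^sub>R z \<in> normalized_lattice L"
      unfolding normalized_lattice_def mn using z(1) by (rule imageI)
    ultimately show "t \<in> norm_powers L" unfolding norm_powers_def by blast
  qed
  have "1 < s / r" using s r by simp
  \<comment> \<open>A positive dimension keeps this power apart from the removed value 1.\<close>
  then have gt: "1 < (s / r) ^ dim L" using dim by (intro one_less_power) auto
  show ?thesis
    unfolding n_L_def
  proof (rule cInf_eq_minimum)
    show "(s / r) ^ dim L \<in> norm_powers L - {1}"
      using z1 gt s r by (auto simp: np intro!: exI[of _ z1])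
    fix x assume "x \<in> norm_powers L - {1}"
    then obtain z where z: "z \<in> L" "z \<noteq> 0" "x = (norm z / r) ^ dim L" "x \<noteq> 1"
      by (auto simp: np)
    have "norm z \<noteq> r" using z r by auto
    then have "s \<le> norm z" using second z by blast
    then show "(s / r) ^ dim L \<le> x"
      unfolding z using s r by (intro power_mono divide_right_mono) auto
  qed
qed

theorem (in tight_lattice) lattice_code_optimal:
  assumes nL: "n_L L = real n"
    and min: "\<And>z. z \<in> L \<Longrightarrow> z \<noteq> 0 \<Longrightarrow> r \<le> norm z" and r: "0 < r" and R: "0 < R"
    and P: "P \<subseteq> L" "finite P" "n < card P"
    and dist: "\<And>p q. p \<in> P \<Longrightarrow> q \<in> P \<Longrightarrow> R * norm (p - q) \<le> r\<^sup>2"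
    and ex: "\<exists>C. lattice_code L C \<and> finite C \<and> card C = n"
  shows "lattice_code_optimal_unique L"
  unfolding lattice_code_optimal_unique_def
proof (intro conjI[OF _ allI] impI)
  show "\<exists>C. lattice_code L C \<and> finite C \<and> real (card C) = n_L L" using ex nL by auto
  fix C assume C: "lattice_code L C \<and> finite C \<and> real (card C) = n_L L"
  then have n: "card C = n" using nL by simp
  have "separated L R C"
    using lattice_code_separated[OF min P(1,2) _ dist R r] C P(3) n by simp
  then show "optimal_code L (card C) C \<and>
      (\<forall>C'. optimal_code L (card C) C' \<longrightarrow> (\<exists>\<phi>. torus_isometry L \<phi> \<and> C' = \<phi> ` C)) \<and>
      (\<forall>C'. optimal_code L (card C - 1) C' \<longrightarrow> (\<exists>\<phi>. torus_isometry L \<phi> \<and> C' \<subseteq> \<phi> ` C))"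
    unfolding n using separated_optimal C n by blast
qed

section \<open>Half-integral lattices in eight coordinates\<close>

text \<open>\<open>coord\<close> counts coordinates by naturals while the index type is a ring of
  characteristic 8; this turns sums over the type into sums over \<open>k < 8\<close>.\<close>

lemma bij_of_nat_8: "bij_betw (of_nat :: nat \<Rightarrow> 8) {..<8} UNIV"
proof -
  have "a = b" if "(of_nat a :: 8) = of_nat b" "a < 8" "b < 8" "a \<le> b" for a b :: nat
  proof -
    have "(of_nat (b - a) :: 8) = 0" using that by (simp add: of_nat_diff)
    then have "8 dvd b - a" using of_nat_eq_0_iff_char_dvd[where 'a = 8] by simp
    then show ?thesis using that by (auto dest: dvd_imp_le)
  qed
  then have inj: "inj_on (of_nat :: nat \<Rightarrow> 8) {..<8}"
    by (metis inj_onI lessThan_iff nat_le_linear)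
  then have "card ((of_nat :: nat \<Rightarrow> 8) ` {..<8}) = CARD(8)" by (simp add: card_image)
  then have "(of_nat :: nat \<Rightarrow> 8) ` {..<8} = UNIV" by (intro card_seteq) auto
  then show ?thesis using inj by (simp add: bij_betw_def)
qed

definition vec8 :: "(nat \<Rightarrow> real) \<Rightarrow> real^8" where
  "vec8 f = (\<chi> i. f (inv_into {..<8} of_nat i))"

lemma coord_vec8 [simp]: "k < 8 \<Longrightarrow> coord (vec8 f) k = f k"
  using bij_of_nat_8 by (simp add: coord_def vec8_def bij_betw_def inv_into_f_f)

lemma coord_zero [simp]: "coord 0 k = 0"
  and coord_add [simp]: "coord (x + y) k = coord x k + coord y k"
  and coord_diff [simp]: "coord (x - y) k = coord x k - coord y k"
  and coord_uminus [simp]: "coord (- x) k = - coord x k"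
  and coord_scaleR [simp]: "coord (c *\<^sub>R x) k = c * coord x k"
  by (simp_all add: coord_def)

lemma coord_sum: "coord (\<Sum>i\<in>I. f i) k = (\<Sum>i\<in>I. coord (f i) k)"
  by (simp add: coord_def)

lemma vec8_eqI: "(\<And>k. k < 8 \<Longrightarrow> coord x k = coord y k) \<Longrightarrow> x = y"
  unfolding coord_def vec_eq_iff using bij_of_nat_8
  by (metis UNIV_I bij_betw_def image_iff lessThan_iff)

lemma inner_coord: "x \<bullet> y = (\<Sum>k<8. coord x k * coord y k)"
  using sum.reindex_bij_betw[OF bij_of_nat_8, of "\<lambda>i. x $ i * y $ i"]
  by (simp add: inner_vec_def coord_def)

lemma norm_coord: "(norm x)\<^sup>2 = (\<Sum>k<8. (coord x k)\<^sup>2)"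
  unfolding power2_norm_eq_inner inner_coord by (simp add: power2_eq_square)

lemma sum_8: "(\<Sum>k<8. f k) = f 0 + f 1 + f 2 + f 3 + f 4 + f 5 + f 6 + f (7::nat)"
  for f :: "nat \<Rightarrow> 'a::comm_monoid_add"
  by (simp add: eval_nat_numeral)

lemma sum_4: "(\<Sum>k<4. f k) = f 0 + f 1 + f 2 + f (3::nat)"
  for f :: "nat \<Rightarrow> 'a::comm_monoid_add"
  by (simp add: eval_nat_numeral)

lemma all_less_8: "(\<forall>k<8. P k) \<longleftrightarrow> P 0 \<and> P 1 \<and> P 2 \<and> P 3 \<and> P 4 \<and> P 5 \<and> P 6 \<and> P (7::nat)"
  by (simp add: eval_nat_numeral All_less_Suc conj_ac)

text \<open>Each coordinate is bounded by the norm and runs through a discrete set. This finiteness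
  makes a closest lattice vector exist.\<close>

lemma finite_half_integral_ball:
  "finite {z :: real^8. (\<forall>k<8. 2 * coord z k \<in> \<int>) \<and> norm (x - z) \<le> b}"
proof -
  define I :: "nat \<Rightarrow> real set" where "I k = {t. 2 * t \<in> \<int> \<and> \<bar>coord x k - t\<bar> \<le> b}" for k
  have fin: "finite (I k)" for k
  proof -
    have "finite {s \<in> \<int>. 2 * (coord x k - b) \<le> s \<and> s \<le> 2 * (coord x k + b)}"
      by (rule finite_int_segment)
    then have "finite ((\<lambda>s. s / 2) ` {s \<in> \<int>. 2 * (coord x k - b) \<le> s \<and> s \<le> 2 * (coord x k + b)})"
      by simp
    then show ?thesis
      by (rule rev_finite_subset) (auto simp: I_def abs_le_iff intro!: image_eqI[of _ _ "2 * _"])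
  qed
  have "{z. (\<forall>k<8. 2 * coord z k \<in> \<int>) \<and> norm (x - z) \<le> b} \<subseteq> vec8 ` (PiE {..<8} I)"
  proof
    fix z assume z: "z \<in> {z. (\<forall>k<8. 2 * coord z k \<in> \<int>) \<and> norm (x - z) \<le> b}"
    have "\<bar>coord (x - z) k\<bar> \<le> norm (x - z)" for k
      unfolding coord_def by (rule component_le_norm_cart)
    then have "restrict (coord z) {..<8} \<in> PiE {..<8} I"
      using z by (force simp: I_def intro: order_trans)
    moreover have "z = vec8 (restrict (coord z) {..<8})" by (rule vec8_eqI) simp
    ultimately show "z \<in> vec8 ` (PiE {..<8} I)" by blast
  qed
  then show ?thesis using finite_PiE[of "{..<8}" I] fin by (auto intro: finite_subset)
qed

section \<open>Voronoi cells and the facts to be checked for each lattice\<close>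

definition shortest :: "'a::real_normed_vector set \<Rightarrow> 'a \<Rightarrow> bool" where
  "shortest L y \<longleftrightarrow> (\<forall>l\<in>L. norm y \<le> norm (y - l))"

text \<open>\<open>shortest L y\<close> places \<open>y\<close> in the closed Voronoi cell of the
  origin, and squaring turns the condition for one lattice vector into a half-space. Below it is
  applied to vectors of squared norm 2.\<close>

lemma shortest_inner_le:
  assumes "shortest L (y :: 'a::real_inner)" "r \<in> L"
  shows "2 * (y \<bullet> r) \<le> (norm r)\<^sup>2"
proof -
  have "(norm y)\<^sup>2 \<le> (norm (y - r))\<^sup>2"
    using assms by (intro power_mono) (auto simp: shortest_def)
  then show ?thesis
    by (simp add: power2_norm_eq_inner inner_diff_left inner_diff_right inner_commute)
qed

locale half_integral_lattice = additive_lattice L for L :: "(real^8) set" +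
  assumes half: "\<And>z k. z \<in> L \<Longrightarrow> k < 8 \<Longrightarrow> 2 * coord z k \<in> \<int>"
begin

lemma exists_shortest:
  obtains l where "l \<in> L" "shortest L (x - l)"
proof -
  \<comment> \<open>Only lattice vectors at least as close to \<open>x\<close> as 0 compete, and
    they are finitely many; the others lose against 0.\<close>
  define F where "F = {l \<in> L. norm (x - l) \<le> norm x}"
  have "finite F"
    by (rule finite_subset[OF _ finite_half_integral_ball[of x "norm x"]]) (auto simp: F_def half)
  moreover have "0 \<in> F" by (simp add: F_def zero_mem)
  ultimately obtain l where l: "l \<in> F" "\<forall>l'\<in>F. norm (x - l) \<le> norm (x - l')"
    using finite_has_minimal[of "(\<lambda>l. norm (x - l)) ` F"]
    by (metis arg_min_if_finite(1) arg_min_least empty_iff)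
  have "norm (x - l) \<le> norm (x - l - l')" if "l' \<in> L" for l'
  proof (cases "l + l' \<in> F")
    case True
    then show ?thesis using l by (metis diff_diff_eq)
  next
    case False
    then have "norm x < norm (x - (l + l'))" using l that add_mem by (auto simp: F_def)
    then show ?thesis using l \<open>0 \<in> F\<close> by (fastforce simp: diff_diff_eq)
  qed
  then show ?thesis using l that by (auto simp: F_def shortest_def)
qed

lemma covering_by_shortest:
  assumes bound: "\<And>y. y \<in> span L \<Longrightarrow> shortest L y \<Longrightarrow> norm y \<le> R" and x: "x \<in> span L"
  shows "\<exists>l\<in>L. norm (x - l) \<le> R"
  using exists_shortest[of x] bound x by (metis span_base span_diff)

text \<open>Subtracting a closest lattice vector does not change the class, so deep holes can be
  classified inside the Voronoi cell.\<close>

lemma hole_by_shortest: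
  assumes x: "x \<in> span L" "\<forall>l\<in>L. sqrt \<rho> \<le> norm (x - l)"
  obtains y where "y \<in> span L" "shortest L y" "\<rho> \<le> (norm y)\<^sup>2" "tcoset L x = tcoset L y"
proof -
  obtain l where l: "l \<in> L" "shortest L (x - l)" by (rule exists_shortest)
  then have "\<rho> \<le> (norm (x - l))\<^sup>2" using x by (blast intro: sqrt_le_D)
  then show ?thesis using x l that[of "x - l"] by (auto simp: span_base span_diff tcoset_eq_iff)
qed

end

text \<open>\<open>\<rho>\<close> stands for the squared covering radius and \<open>\<sigma>\<close>
  for the second smallest squared norm; as their product is 4 in every application, \<open>P\<close>
  may have squared distances up to \<open>\<sigma>\<close>. \<open>T\<close> is a similarity of
  squared ratio \<open>\<rho> / 2\<close>, and \<open>s\<close> has absolute value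
  \<open>2 / \<rho>\<close> because it must undo two applications of \<open>T\<close>.\<close>

lemma (in half_integral_lattice) lattice_code_theorem:
  fixes \<rho> \<sigma> :: real
  assumes n: "2 \<le> n" and \<rho>: "0 < \<rho>" and \<sigma>: "2 < \<sigma>"
    and min: "\<And>z. z \<in> L \<Longrightarrow> z \<noteq> 0 \<Longrightarrow> 2 \<le> (norm z)\<^sup>2"
    and u: "u \<in> L" "(norm u)\<^sup>2 = 2" and v: "v \<in> L" "(norm v)\<^sup>2 = \<sigma>"
    and second: "\<And>z. z \<in> L \<Longrightarrow> z \<noteq> 0 \<Longrightarrow> (norm z)\<^sup>2 \<noteq> 2 \<Longrightarrow> \<sigma> \<le> (norm z)\<^sup>2"
    and dim: "0 < dim L" "sqrt (\<sigma> / 2) ^ dim L = real n"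
    and cover: "\<And>y. y \<in> span L \<Longrightarrow> shortest L y \<Longrightarrow> (norm y)\<^sup>2 \<le> \<rho>"
    and embed: "\<And>C C'. separated L (sqrt \<rho>) C \<Longrightarrow> finite C \<Longrightarrow> card C = n \<Longrightarrow>
      separated L (sqrt \<rho>) C' \<Longrightarrow> \<exists>\<phi>. torus_isometry L \<phi> \<and> C' \<subseteq> \<phi> ` C"
    and upper: "\<And>C. separated L (sqrt \<rho>) C \<Longrightarrow> tcoset L 0 \<in> C \<Longrightarrow> finite C \<and> card C \<le> n"
    and P: "P \<subseteq> L" "finite P" "n < card P"
      "\<And>p q. p \<in> P \<Longrightarrow> q \<in> P \<Longrightarrow> \<rho> * (norm (p - q))\<^sup>2 \<le> 4"
    and T: "linear T" "\<And>x. x \<in> span L \<Longrightarrow> 2 * (norm (T x))\<^sup>2 = \<rho> * (norm x)\<^sup>2"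
    and s: "s \<noteq> 0" "\<And>l. l \<in> L \<Longrightarrow> s *\<^sub>R T l \<in> L" "\<And>l. l \<in> L \<Longrightarrow> T (s *\<^sub>R T l) = l"
    and G: "G \<subseteq> L" "card G = n" "\<And>x y. x \<in> G \<Longrightarrow> y \<in> G \<Longrightarrow> T (x - y) \<in> L \<Longrightarrow> x = y"
  shows "lattice_code_optimal_unique L"
proof -
  have min': "sqrt 2 \<le> norm z" if "z \<in> L" "z \<noteq> 0" for z
    using min[OF that] by (simp add: real_le_lsqrt)
  have norm_eq: "norm z = sqrt t" if "(norm z)\<^sup>2 = t" for z :: "real^8" and t
    using that by (simp add: real_sqrt_unique)
  interpret tight_lattice L "sqrt \<rho>" n
  proof
    show "\<exists>l\<in>L. norm (x - l) \<le> sqrt \<rho>" if "x \<in> span L" for x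
      using covering_by_shortest[OF _ that] cover by (simp add: real_le_rsqrt)
  qed (use n embed in auto)
  have "n_L L = (sqrt \<sigma> / sqrt 2) ^ dim L"
  proof (rule n_L_eqI[OF min' _ u(1) norm_eq[OF u(2)] v(1) norm_eq[OF v(2)]])
    fix z assume z: "z \<in> L" "z \<noteq> 0" "norm z \<noteq> sqrt 2"
    then have "\<sigma> \<le> (norm z)\<^sup>2" using second norm_eq by blast
    then show "sqrt \<sigma> \<le> norm z" by (simp add: real_le_lsqrt)
  qed (use \<sigma> dim in auto)
  then have nL: "n_L L = real n" using dim by (simp add: real_sqrt_divide)
  have dist: "sqrt \<rho> * norm (p - q) \<le> (sqrt 2)\<^sup>2" if "p \<in> P" "q \<in> P" for p q
    using P(4)[OF that] \<rho> by - (rule power2_le_imp_le, auto simp: power_mult_distrib)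
  have Tn: "norm (T x) = sqrt (\<rho> / 2) * norm x" if "x \<in> span L" for x
    using T(2)[OF that] \<rho> by - (rule power2_eq_imp_eq, auto simp: power_mult_distrib)
  have "\<exists>C. lattice_code L C \<and> finite C \<and> card C = n"
    using \<rho> by (intro exists_lattice_code[OF min' T(1) Tn _ _ s upper G])
      (auto simp: real_sqrt_divide)
  then show ?thesis
    using \<rho> by (intro lattice_code_optimal[OF nL min' _ _ P(1,2,3) dist]) auto
qed

section \<open>Explicit vectors and membership in the lattices\<close>

definition lvec :: "real list \<Rightarrow> real^8" where
  "lvec xs = vec8 (\<lambda>k. if k < length xs then xs ! k else 0)"

lemma coord_lvec [simp]: "k < 8 \<Longrightarrow> coord (lvec xs) k = (if k < length xs then xs ! k else 0)"
  by (simp add: lvec_def)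

lemmas norm_coord_8 = norm_coord[unfolded sum_8]
lemmas inner_coord_8 = inner_coord[unfolded sum_8]

lemma vec8_eq_iff: "x = y \<longleftrightarrow> (\<forall>k<8. coord x k = coord y k)"
  using vec8_eqI by blast

lemmas vec8_eq_iff_8 = vec8_eq_iff[unfolded all_less_8]

lemma all_between_8:
  "(\<forall>k. 1 < k \<and> k < 8 \<longrightarrow> P k) \<longleftrightarrow> P 2 \<and> P 3 \<and> P 4 \<and> P 5 \<and> P 6 \<and> P (7::nat)"
  "(\<forall>k. 2 < k \<and> k < 8 \<longrightarrow> P k) \<longleftrightarrow> P 3 \<and> P 4 \<and> P 5 \<and> P 6 \<and> P (7::nat)"
  "(\<forall>k. 4 \<le> k \<and> k < 8 \<longrightarrow> P k) \<longleftrightarrow> P 4 \<and> P 5 \<and> P 6 \<and> P (7::nat)"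
proof -
  have swap: "(\<forall>k. Q k \<and> k < 8 \<longrightarrow> P k) \<longleftrightarrow> (\<forall>k<8. Q k \<longrightarrow> P k)" for Q P :: "nat \<Rightarrow> bool"
    by (intro iffI allI impI) simp_all
  show "(\<forall>k. 1 < k \<and> k < 8 \<longrightarrow> P k) \<longleftrightarrow> P 2 \<and> P 3 \<and> P 4 \<and> P 5 \<and> P 6 \<and> P (7::nat)"
    "(\<forall>k. 2 < k \<and> k < 8 \<longrightarrow> P k) \<longleftrightarrow> P 3 \<and> P 4 \<and> P 5 \<and> P 6 \<and> P (7::nat)"
    "(\<forall>k. 4 \<le> k \<and> k < 8 \<longrightarrow> P k) \<longleftrightarrow> P 4 \<and> P 5 \<and> P 6 \<and> P (7::nat)"
    unfolding swap all_less_8 by simp_all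
qed

lemma mem_A1: "x \<in> A_lattice 1 \<longleftrightarrow> coord x 0 \<in> \<int> \<and> coord x 1 = - coord x 0 \<and>
    coord x 2 = 0 \<and> coord x 3 = 0 \<and> coord x 4 = 0 \<and> coord x 5 = 0 \<and> coord x 6 = 0 \<and> coord x 7 = 0"
proof -
  have "(\<Sum>k\<le>1. coord x k) = 0 \<longleftrightarrow> coord x 1 = - coord x 0" by (auto simp: add_eq_0_iff)
  then show ?thesis
    unfolding A_lattice_def mem_Collect_eq all_less_8 all_between_8 by auto
qed

lemma mem_A2: "x \<in> A_lattice 2 \<longleftrightarrow> coord x 0 \<in> \<int> \<and> coord x 1 \<in> \<int> \<and>
    coord x 2 = - coord x 0 - coord x 1 \<and>
    coord x 3 = 0 \<and> coord x 4 = 0 \<and> coord x 5 = 0 \<and> coord x 6 = 0 \<and> coord x 7 = 0"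
proof -
  have "(\<Sum>k\<le>2. coord x k) = 0 \<longleftrightarrow> coord x 2 = - coord x 0 - coord x 1"
    by (auto simp: numeral_2_eq_2 add_eq_0_iff)
  then show ?thesis
    unfolding A_lattice_def mem_Collect_eq all_less_8 all_between_8 by auto
qed

lemma ex_even_iff: "(\<exists>j::int. t = of_int (2 * j)) \<longleftrightarrow> t / 2 \<in> \<int>" for t :: real
proof
  assume "t / 2 \<in> \<int>"
  then obtain j where "t / 2 = of_int j" by (rule Ints_cases)
  then have "t = of_int (2 * j)" by simp
  then show "\<exists>j::int. t = of_int (2 * j)" ..
next
  assume "\<exists>j::int. t = of_int (2 * j)"
  then obtain j :: int where "t = of_int (2 * j)" ..
  then have "t / 2 = of_int j" by simp
  then show "t / 2 \<in> \<int>" by simp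
qed

lemma mem_D4: "x \<in> D4_lattice \<longleftrightarrow> coord x 0 \<in> \<int> \<and> coord x 1 \<in> \<int> \<and> coord x 2 \<in> \<int> \<and> coord x 3 \<in> \<int> \<and>
    (coord x 0 + coord x 1 + coord x 2 + coord x 3) / 2 \<in> \<int> \<and>
    coord x 4 = 0 \<and> coord x 5 = 0 \<and> coord x 6 = 0 \<and> coord x 7 = 0"
  unfolding D4_lattice_def mem_Collect_eq all_less_8 all_between_8 ex_even_iff sum_4
  by (intro iffI) simp_all

lemma half_integral_A1: "half_integral_lattice (A_lattice 1)"
proof
  show "2 * coord z k \<in> \<int>" if "z \<in> A_lattice 1" "k < 8" for z k
    using that by (simp add: A_lattice_def)
qed (auto simp: mem_A1[simplified])

lemma half_integral_A2: "half_integral_lattice (A_lattice 2)"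
proof
  show "2 * coord z k \<in> \<int>" if "z \<in> A_lattice 2" "k < 8" for z k
    using that by (simp add: A_lattice_def)
qed (auto simp: mem_A2)

lemma half_integral_D4: "half_integral_lattice (D4_lattice)"
proof
  show "2 * coord z k \<in> \<int>" if "z \<in> D4_lattice" "k < 8" for z k
    using that by (simp add: D4_lattice_def)
next
  fix x y assume xy: "x \<in> D4_lattice" "y \<in> D4_lattice"
  have "(coord (x - y) 0 + coord (x - y) 1 + coord (x - y) 2 + coord (x - y) 3) / 2 =
      (coord x 0 + coord x 1 + coord x 2 + coord x 3) / 2 - (coord y 0 + coord y 1 + coord y 2 + coord y 3) / 2"
    by (simp add: add_divide_distrib diff_divide_distrib)
  also have "\<dots> \<in> \<int>" using xy unfolding mem_D4 by (intro Ints_diff) blast+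
  finally show "x - y \<in> D4_lattice" using xy unfolding mem_D4 by auto
qed (auto simp: mem_D4)

text \<open>A product of consecutive integers is even, so a sum of squares has the parity of the sum
  itself; this makes the squared norms of D_4 and E_8 even.\<close>

lemma sum_squares_even: "(\<Sum>k\<in>A. (x k)\<^sup>2 + x k) / 2 \<in> \<int>" if "\<And>k. k \<in> A \<Longrightarrow> x k \<in> \<int>" for x :: "'b \<Rightarrow> real"
proof -
  have "((x k)\<^sup>2 + x k) / 2 \<in> \<int>" if "k \<in> A" for k
  proof -
    obtain i where i: "x k = of_int i" using \<open>\<And>k. k \<in> A \<Longrightarrow> x k \<in> \<int>\<close> \<open>k \<in> A\<close> by (meson Ints_cases)
    have "even (i\<^sup>2 + i)" by simp
    then obtain j where j: "i\<^sup>2 + i = 2 * j" by (rule evenE)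
    have "(x k)\<^sup>2 + x k = of_int (i\<^sup>2 + i)" by (simp add: i)
    also have "\<dots> = 2 * of_int j" by (simp only: j of_int_mult of_int_numeral)
    finally show ?thesis by simp
  qed
  then show ?thesis unfolding sum_divide_distrib by (rule Ints_sum)
qed

definition e8 :: "nat \<Rightarrow> real^8" where
  "e8 j = vec8 (\<lambda>k. if k = j then 1 else 0)"

lemma coord_e8 [simp]: "k < 8 \<Longrightarrow> coord (e8 j) k = (if k = j then 1 else 0)"
  by (simp add: e8_def)

lemma inner_e8: "j < 8 \<Longrightarrow> y \<bullet> e8 j = coord y j"
  by (simp add: inner_coord if_distrib cong: if_cong)

lemma sum_coord_e8: "j < N \<Longrightarrow> N \<le> 8 \<Longrightarrow> (\<Sum>k<N. coord (e8 j) k) = 1"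
proof -
  assume "j < N" "N \<le> 8"
  then have "(\<Sum>k<N. coord (e8 j) k) = (\<Sum>k<N. if k = j then 1 else 0)" by (intro sum.cong) auto
  then show ?thesis using \<open>j < N\<close> by simp
qed

lemma e8_Basis:
  assumes "k < 8"
  shows "e8 k \<in> Basis"
proof -
  have "e8 k = axis (of_nat k) 1"
  proof (rule vec8_eqI)
    fix i :: nat assume "i < 8"
    moreover have "(of_nat k :: 8) = of_nat i \<longleftrightarrow> k = i"
      using bij_of_nat_8 assms \<open>i < 8\<close> unfolding bij_betw_def by (metis inj_on_eq_iff lessThan_iff)
    ultimately show "coord (e8 k) i = coord (axis (of_nat k) 1) i"
      unfolding coord_def[of "axis (of_nat k) 1"] by (auto simp: axis_def)
  qed
  then show ?thesis by (simp add: axis_in_Basis_iff)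
qed

lemma norm_two_e8:
  assumes "j < 8" "k < 8" "j \<noteq> k" "s = 1 \<or> s = -1" "t = 1 \<or> t = -1"
  shows "(norm (s *\<^sub>R e8 j + t *\<^sub>R e8 k))\<^sup>2 = 2"
  using assms by (auto simp: power2_norm_eq_inner inner_add_right inner_diff_right inner_e8)

text \<open>Giving \<open>s\<close> and \<open>t\<close> the signs of the two coordinates selects
  the strongest of the four root inequalities.\<close>

lemma shortest_pair:
  assumes y: "shortest L y" and jk: "j < 8" "k < 8" "j \<noteq> k"
    and roots: "\<And>s t. s = 1 \<or> s = -1 \<Longrightarrow> t = 1 \<or> t = -1 \<Longrightarrow> s *\<^sub>R e8 j + t *\<^sub>R e8 k \<in> L"
  shows "\<bar>coord y j\<bar> + \<bar>coord y k\<bar> \<le> 1"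
proof -
  define s t :: real where "s = (if coord y j < 0 then -1 else 1)" and "t = (if coord y k < 0 then -1 else 1)"
  have st: "s = 1 \<or> s = -1" "t = 1 \<or> t = -1" by (auto simp: s_def t_def)
  have "2 * (y \<bullet> (s *\<^sub>R e8 j + t *\<^sub>R e8 k)) \<le> 2"
    using shortest_inner_le[OF y roots[OF st]] norm_two_e8[OF jk st] by simp
  moreover have "s * coord y j = \<bar>coord y j\<bar>" "t * coord y k = \<bar>coord y k\<bar>"
    by (auto simp: s_def t_def)
  ultimately show ?thesis using jk by (simp add: inner_add_right inner_e8)
qed

lemma Ints_half_cases: "(t::real) \<in> \<int> \<Longrightarrow> t / 2 \<in> \<int> \<or> (t + 1) / 2 \<in> \<int>"
proof -
  assume "t \<in> \<int>"
  then obtain i where i: "t = of_int i" by (rule Ints_cases)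
  then consider j where "i = 2 * j" | j where "i = 2 * j + 1" by (metis evenE oddE)
  then show ?thesis
  proof cases
    case 1
    then have "t / 2 = of_int j" using i by simp
    then show ?thesis by simp
  next
    case 2
    then have "(t + 1) / 2 = of_int (j + 1)" using i by simp
    then show ?thesis by (metis Ints_of_int)
  qed
qed

lemma even_pos_ge:
  assumes "(t::real) / 2 \<in> \<int>" "0 < t"
  shows "2 \<le> t" and "t \<noteq> 2 \<Longrightarrow> 4 \<le> t"
proof -
  obtain i where i: "t / 2 = of_int i" using assms(1) by (rule Ints_cases)
  then have t: "t = 2 * of_int i" by simp
  then have "1 \<le> i" using assms(2) by simp
  then show "2 \<le> t" unfolding t by simp
  assume "t \<noteq> 2"
  then have "2 \<le> i" using \<open>1 \<le> i\<close> t by (cases "i = 1") auto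
  then show "4 \<le> t" unfolding t by simp
qed

lemma half_notin_Ints: "(1/2::real) \<notin> \<int>"
proof
  assume "(1/2::real) \<in> \<int>"
  then show False using even_pos_ge(1)[of 1] by simp
qed

section \<open>The lattice \<open>A_1\<close>\<close>

lemma Ints_square_ge: "(x::real) \<in> \<int> \<Longrightarrow> x \<noteq> 0 \<Longrightarrow> 1 \<le> x\<^sup>2"
  using Ints_nonzero_abs_ge1[of x] by (simp add: abs_le_square_iff[of 1 x, simplified, symmetric])

lemma span_A1:
  assumes "y \<in> span (A_lattice 1)"
  shows "coord y 1 = - coord y 0 \<and> coord y 2 = 0 \<and> coord y 3 = 0 \<and> coord y 4 = 0 \<and>
    coord y 5 = 0 \<and> coord y 6 = 0 \<and> coord y 7 = 0" (is "?P y")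
proof -
  have "span (A_lattice 1) \<subseteq> {y. ?P y}"
    by (rule span_minimal) (auto simp: mem_A1[simplified] subspace_def algebra_simps)
  then show ?thesis using assms by blast
qed

theorem A1_codes: "lattice_code_optimal_unique (A_lattice 1)"
proof -
  define L where "L = A_lattice 1"
  note mem = mem_A1[folded L_def] and spanL = span_A1[folded L_def]
  interpret half_integral_lattice L unfolding L_def by (rule half_integral_A1)
  let ?r = "lvec [1, -1]" and ?h = "lvec [1/2, -1/2]"
  have r: "?r \<in> L" "- ?r \<in> L" by (auto simp: mem)
  have norm: "(norm y)\<^sup>2 = 2 * (coord y 0)\<^sup>2" if "y \<in> span L" for y
    using spanL[OF that] by (simp add: norm_coord_8)
  note normL = norm[OF span_base]
  have bound: "\<bar>coord y 0\<bar> \<le> 1/2" if "y \<in> span L" "shortest L y" for y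
    using spanL[OF that(1)] shortest_inner_le[OF that(2) r(1)] shortest_inner_le[OF that(2) r(2)]
    by (simp add: inner_coord_8 norm_coord_8)
  have bound2: "(coord y 0)\<^sup>2 \<le> 1/4" if "y \<in> span L" "shortest L y" for y
    using abs_le_square_iff[of "coord y 0" "1/2"] bound[OF that] by (simp add: power2_eq_square)
  have hole: "tcoset L x \<in> {tcoset L ?h}" if x: "x \<in> span L" "\<forall>l\<in>L. sqrt (1/2) \<le> norm (x - l)" for x
  proof -
    obtain y where y: "y \<in> span L" "shortest L y" "1/2 \<le> (norm y)\<^sup>2" "tcoset L x = tcoset L y"
      using hole_by_shortest[OF x] by blast
    have "(coord y 0)\<^sup>2 = (1/2)\<^sup>2"
      using y(3) bound2[OF y(1,2)] norm[OF y(1)] by (simp add: power2_eq_square)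
    \<comment> \<open>The two end points of the cell differ by the generator \<open>?r\<close>,
      hence give a single class.\<close>
    then have "coord y 0 - 1/2 = 0 \<or> coord y 0 - 1/2 = -1" by (simp add: power2_eq_iff) linarith
    then have "coord y 0 - 1/2 \<in> \<int>" by (metis Ints_0 Ints_1 Ints_minus)
    then have "y - ?h \<in> L" using spanL[OF y(1)] by (auto simp: mem)
    then have "tcoset L y = tcoset L ?h" by (simp only: tcoset_eq_iff)
    then show ?thesis using y(4) by simp
  qed
  have "L \<subseteq> span {?r}"
  proof
    fix x assume x: "x \<in> L"
    then have "x = coord x 0 *\<^sub>R ?r" by (simp add: vec8_eq_iff_8 mem)
    then show "x \<in> span {?r}" by (metis span_base span_scale singletonI)
  qed
  then have "span L = span {?r}" using r by (intro span_eq[THEN iffD2]) (auto simp: span_base)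
  moreover have "?r \<noteq> 0" by (auto simp: vec8_eq_iff_8)
  ultimately have dim: "dim L = 1" by (metis dim_singleton dim_span)
  have upper: "finite C \<and> card C \<le> 2" if "separated L (sqrt (1/2)) C" "tcoset L 0 \<in> C" for C
    by (rule separated_card_few_holes[OF _ _ hole that]) (simp_all add: card_insert_if)
  have "lattice_code_optimal_unique L"
  \<comment> \<open>The lattice is generated by \<open>?r\<close>: its half is the deep hole, its
    double has the second norm and is the longest difference in \<open>P\<close>, and halving is the
    similarity, which \<open>s = 4\<close> undoes when applied twice.\<close>
  proof (rule lattice_code_theorem[where n = 2 and \<rho> = "1/2" and \<sigma> = 8 and u = ?r and v = "2 *\<^sub>R ?r"
        and P = "{0, ?r, - ?r}" and T = "\<lambda>x. (1/2) *\<^sub>R x" and s = 4 and G = "{0, ?r}"])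
    fix z assume z: "z \<in> L" "z \<noteq> 0"
    then have nz: "coord z 0 \<noteq> 0" "coord z 0 \<in> \<int>" by (auto simp: mem vec8_eq_iff_8)
    then show "2 \<le> (norm z)\<^sup>2" using normL[OF z(1)] Ints_square_ge by auto
    assume "(norm z)\<^sup>2 \<noteq> 2"
    then have "\<bar>coord z 0\<bar> \<noteq> 1" using normL[OF z(1)] by (auto simp: abs_square_eq_1)
    moreover obtain i where "coord z 0 = of_int i" using nz by (auto elim: Ints_cases)
    ultimately have "2 \<le> \<bar>coord z 0\<bar>" using nz by (cases "\<bar>i\<bar> \<le> 1") auto
    then have "4 \<le> (coord z 0)\<^sup>2" using abs_le_square_iff[of 2 "coord z 0"] by simp
    then show "8 \<le> (norm z)\<^sup>2" using normL[OF z(1)] by auto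
  next
    show "\<exists>\<phi>. torus_isometry L \<phi> \<and> C' \<subseteq> \<phi> ` C"
      if "separated L (sqrt (1/2)) C" "finite C" "card C = 2" "separated L (sqrt (1/2)) C'" for C C'
      by (rule separated_embedding_few_holes[OF _ _ hole that]) auto
  next
    show "(norm y)\<^sup>2 \<le> 1/2" if "y \<in> span L" "shortest L y" for y
      using bound2[OF that] norm[OF that(1)] by auto
  next
    have "distinct [0, ?r, - ?r]" by (auto simp: vec8_eq_iff_8)
    from distinct_card[OF this] show "2 < card {0, ?r, - ?r}" by simp
    have "\<not> (1/2::real) \<in> \<int>" by (auto elim!: Ints_cases)
    then show "x = y" if "x \<in> {0, ?r}" "y \<in> {0, ?r}" "(1/2) *\<^sub>R (x - y) \<in> L" for x y
      using that by (auto simp: mem)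
    show "\<And>p q. p \<in> {0, ?r, - ?r} \<Longrightarrow> q \<in> {0, ?r, - ?r} \<Longrightarrow> 1/2 * (norm (p - q))\<^sup>2 \<le> 4"
      by (auto simp: norm_coord_8)
    have "distinct [0, ?r]" by (auto simp: vec8_eq_iff_8)
    from distinct_card[OF this] show "card {0, ?r} = 2" by simp
    show "linear (\<lambda>x::real^8. (1/2) *\<^sub>R x)" by (rule linear_scaleR)
    show "(norm (2 *\<^sub>R ?r))\<^sup>2 = 8" by (simp only: norm_coord_8) simp
    show "(norm ?r)\<^sup>2 = 2" by (simp only: norm_coord_8) simp
  qed (use r dim upper in \<open>auto simp: mem power2_eq_square\<close>)
  then show ?thesis by (simp add: L_def)
qed

section \<open>The lattice \<open>A_2\<close>\<close>

lemma span_A2: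
  assumes "y \<in> span (A_lattice 2)"
  shows "coord y 2 = - coord y 0 - coord y 1 \<and> coord y 3 = 0 \<and> coord y 4 = 0 \<and>
    coord y 5 = 0 \<and> coord y 6 = 0 \<and> coord y 7 = 0" (is "?P y")
proof -
  have "span (A_lattice 2) \<subseteq> {y. ?P y}"
    by (rule span_minimal) (auto simp: mem_A2 subspace_def right_diff_distrib)
  then show ?thesis using assms by blast
qed

text \<open>The form is half the squared norm on A_2. Completing the square gives positivity; 2 is
  not a value, since an even value forces both variables even, and then 4 divides it.\<close>

lemma A2_form_ge:
  fixes a b :: int
  assumes "a \<noteq> 0 \<or> b \<noteq> 0"
  shows "1 \<le> a\<^sup>2 + a * b + b\<^sup>2" and "a\<^sup>2 + a * b + b\<^sup>2 \<noteq> 1 \<Longrightarrow> 3 \<le> a\<^sup>2 + a * b + b\<^sup>2"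
proof -
  let ?q = "a\<^sup>2 + a * b + b\<^sup>2"
  have eq: "4 * ?q = (2 * a + b)\<^sup>2 + 3 * b\<^sup>2" by (simp add: power2_eq_square algebra_simps)
  moreover have "0 < (2 * a + b)\<^sup>2 + 3 * b\<^sup>2"
    using assms by (cases "b = 0") (auto intro: add_nonneg_pos)
  ultimately have "0 < 4 * ?q" by metis
  then show pos: "1 \<le> ?q" by (simp add: int_one_le_iff_zero_less)
  have "?q \<noteq> 2"
  proof
    assume q: "?q = 2"
    then have "even ?q" by simp
    then have "even a \<and> even b" by auto
    then obtain c d where "a = 2 * c" "b = 2 * d" by (auto elim!: evenE)
    then have "4 * (c\<^sup>2 + c * d + d\<^sup>2) = 2" using q by (simp add: power2_eq_square algebra_simps)
    then show False by presburger
  qed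
  then have "3 \<le> q" if "q = ?q" "q \<noteq> 1" for q using pos that by simp
  then show "?q \<noteq> 1 \<Longrightarrow> 3 \<le> ?q" by blast
qed

text \<open>In the inner products \<open>p\<close>, \<open>q\<close> with two roots the Voronoi cell
  of A_2 is this hexagon, and the form is 3/2 times the squared norm. The form is each of three
  squares plus a product, and some product is nonpositive, so the form is at most the corresponding
  square. Equality makes that product vanish and leaves six vertices.\<close>

lemma hexagon_bound:
  fixes p q :: real
  assumes "\<bar>p\<bar> \<le> 1" "\<bar>q\<bar> \<le> 1" "\<bar>p + q\<bar> \<le> 1"
  shows "p\<^sup>2 + p * q + q\<^sup>2 \<le> 1"
    and "1 \<le> p\<^sup>2 + p * q + q\<^sup>2 \<Longrightarrow>
      (p = 0 \<and> (q = 1 \<or> q = -1)) \<or> (q = 0 \<and> (p = 1 \<or> p = -1)) \<or> (p = - q \<and> (q = 1 \<or> q = -1))"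
proof -
  have sq: "p\<^sup>2 \<le> 1" "q\<^sup>2 \<le> 1" "(p + q)\<^sup>2 \<le> 1"
    using assms by (simp_all add: abs_square_le_1)
  have eqs: "p\<^sup>2 + p * q + q\<^sup>2 = (p + q)\<^sup>2 - p * q" "p\<^sup>2 + p * q + q\<^sup>2 = p\<^sup>2 + q * (p + q)"
    "p\<^sup>2 + p * q + q\<^sup>2 = q\<^sup>2 + p * (p + q)"
    by (simp_all add: power2_eq_square algebra_simps)
  have cases: "0 \<le> p * q \<or> q * (p + q) \<le> 0 \<or> p * (p + q) \<le> 0"
    by (smt (verit) mult_nonneg_nonneg mult_nonneg_nonpos mult_nonneg_nonpos2 mult_nonpos_nonpos)
  then show "p\<^sup>2 + p * q + q\<^sup>2 \<le> 1" using sq eqs by linarith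
  assume 1: "1 \<le> p\<^sup>2 + p * q + q\<^sup>2"
  have "(p * q = 0 \<and> (p + q)\<^sup>2 = 1) \<or> (q * (p + q) = 0 \<and> p\<^sup>2 = 1) \<or> (p * (p + q) = 0 \<and> q\<^sup>2 = 1)"
    using cases sq eqs 1 by linarith
  then show "(p = 0 \<and> (q = 1 \<or> q = -1)) \<or> (q = 0 \<and> (p = 1 \<or> p = -1)) \<or> (p = - q \<and> (q = 1 \<or> q = -1))"
    by (auto simp: power2_eq_1_iff add_eq_0_iff)
qed

theorem A2_codes: "lattice_code_optimal_unique (A_lattice 2)"
proof -
  define L where "L = A_lattice 2"
  note mem = mem_A2[folded L_def] and spanL = span_A2[folded L_def]
  interpret half_integral_lattice L unfolding L_def by (rule half_integral_A2)
  \<comment> \<open>\<open>?w\<close> is the centre of the triangle with vertices 0,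
    \<open>?b\<close>, \<open>?c\<close>; together with its negative it represents the deep
    holes.\<close>
  let ?a = "lvec [1, -1, 0]" and ?b = "lvec [0, 1, -1]" and ?c = "lvec [1, 0, -1]"
    and ?w = "lvec [1/3, 1/3, -2/3]"
  \<comment> \<open>A third of the cross product with (1, 1, 1): on the plane a right-angle rotation
    scaled by 1 / sqrt 3. Its square is -1/3, whence \<open>s = -3\<close> below.\<close>
  define T where "T x = lvec [(coord x 1 - coord x 2) / 3, (coord x 2 - coord x 0) / 3,
    (coord x 0 - coord x 1) / 3]" for x
  have T_coord: "coord (T x) 0 = (coord x 1 - coord x 2) / 3" "coord (T x) (Suc 0) = (coord x 2 - coord x 0) / 3"
    "coord (T x) 2 = (coord x 0 - coord x 1) / 3" "coord (T x) 3 = 0" "coord (T x) 4 = 0"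
    "coord (T x) 5 = 0" "coord (T x) 6 = 0" "coord (T x) 7 = 0" for x
    by (simp_all add: T_def)
  have r: "?a \<in> L" "?b \<in> L" "?c \<in> L" by (auto simp: mem)
  note r' = r r[THEN uminus_mem]
  have norm: "(norm y)\<^sup>2 = 2 * ((coord y 0)\<^sup>2 + coord y 0 * coord y 1 + (coord y 1)\<^sup>2)" if "y \<in> span L" for y
  proof -
    note s = spanL[OF that, THEN conjunct1] spanL[OF that, THEN conjunct2]
    show ?thesis unfolding norm_coord_8 by (simp add: s) (simp add: power2_eq_square algebra_simps)
  qed
  note normL = norm[OF span_base]
  \<comment> \<open>The squared norm in the variables of \<open>hexagon_bound\<close>, which are the
    inner products with \<open>?a\<close> and \<open>?b\<close>.\<close>
  have norm': "(norm y)\<^sup>2 = 2 / 3 * ((coord y 0 - coord y 1)\<^sup>2 +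
      (coord y 0 - coord y 1) * (coord y 1 - coord y 2) + (coord y 1 - coord y 2)\<^sup>2)" if "y \<in> span L" for y
    unfolding norm[OF that] spanL[OF that, THEN conjunct1] by (simp add: power2_eq_square algebra_simps)
  have bound: "\<bar>coord y 0 - coord y 1\<bar> \<le> 1 \<and> \<bar>coord y 1 - coord y 2\<bar> \<le> 1 \<and>
      \<bar>(coord y 0 - coord y 1) + (coord y 1 - coord y 2)\<bar> \<le> 1" if "y \<in> span L" "shortest L y" for y
    using spanL[OF that(1)] r'[THEN shortest_inner_le[OF that(2)]]
    by (auto simp: inner_coord_8 norm_coord_8 abs_le_iff)
  have hole: "tcoset L x \<in> {tcoset L ?w, tcoset L (- ?w)}"
    if x: "x \<in> span L" "\<forall>l\<in>L. sqrt (2/3) \<le> norm (x - l)" for x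
  proof -
    obtain y where y: "y \<in> span L" "shortest L y" "2/3 \<le> (norm y)\<^sup>2" "tcoset L x = tcoset L y"
      using hole_by_shortest[OF x] by blast
    let ?p = "coord y 0 - coord y 1" and ?q = "coord y 1 - coord y 2"
    have "2/3 \<le> 2/3 * X \<Longrightarrow> 1 \<le> X" for X :: real by linarith
    then have "1 \<le> ?p\<^sup>2 + ?p * ?q + ?q\<^sup>2" using y(3) norm'[OF y(1)] by metis
    then have "(?p = 0 \<and> (?q = 1 \<or> ?q = -1)) \<or> (?q = 0 \<and> (?p = 1 \<or> ?p = -1)) \<or> (?p = - ?q \<and> (?q = 1 \<or> ?q = -1))"
      using bound[OF y(1,2)] hexagon_bound(2) by blast
    moreover have "coord y 2 = - coord y 0 - coord y 1" using spanL[OF y(1)] by blast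
    \<comment> \<open>Alternate vertices of the hexagon are congruent modulo \<open>L\<close>, so
      the six vertices give two classes.\<close>
    ultimately have "(coord y 0 - 1/3 = 0 \<and> coord y 1 - 1/3 = 0) \<or> (coord y 0 + 1/3 = 0 \<and> coord y 1 + 1/3 = 0) \<or>
        (coord y 0 + 1/3 = 1 \<and> coord y 1 + 1/3 = 0) \<or> (coord y 0 - 1/3 = -1 \<and> coord y 1 - 1/3 = 0) \<or>
        (coord y 0 + 1/3 = 0 \<and> coord y 1 + 1/3 = 1) \<or> (coord y 0 - 1/3 = 0 \<and> coord y 1 - 1/3 = -1)"
      by (elim disjE conjE) (simp_all; linarith)+
    then have "(coord y 0 - 1/3 \<in> \<int> \<and> coord y 1 - 1/3 \<in> \<int>) \<or> (coord y 0 + 1/3 \<in> \<int> \<and> coord y 1 + 1/3 \<in> \<int>)"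
      by (metis Ints_0 Ints_1 Ints_minus)
    then have "y - ?w \<in> L \<or> y - (- ?w) \<in> L"
      using spanL[OF y(1)] by (auto simp: mem)
    then have "tcoset L y = tcoset L ?w \<or> tcoset L y = tcoset L (- ?w)" by (simp only: tcoset_eq_iff)
    then show ?thesis using y(4) by auto
  qed
  have "L \<subseteq> span {?a, ?b}"
  proof
    fix x assume x: "x \<in> L"
    then have "x = coord x 0 *\<^sub>R ?a + (coord x 0 + coord x 1) *\<^sub>R ?b" by (simp add: vec8_eq_iff_8 mem)
    then show "x \<in> span {?a, ?b}" by (metis insertI1 insertI2 span_add span_base span_scale)
  qed
  then have "span L = span {?a, ?b}" using r by (intro span_eq[THEN iffD2]) (auto simp: span_base)
  moreover have "independent {?a, ?b}"
  proof -
    have "?a \<notin> span {?b}"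
      by (auto simp: span_singleton vec8_eq_iff_8)
    moreover have "?b \<noteq> 0" by (auto simp: vec8_eq_iff_8)
    ultimately show ?thesis by (simp add: independent_insert)
  qed
  moreover have ab: "?a \<noteq> ?b" by (auto simp: vec8_eq_iff_8)
  ultimately have dim: "dim L = 2"
    by (metis card_2_iff dim_eq_card)
  have upper: "finite C \<and> card C \<le> 3" if "separated L (sqrt (2/3)) C" "tcoset L 0 \<in> C" for C
    by (rule separated_card_few_holes[OF _ _ hole that]) (simp_all add: card_insert_if)
  have linT: "linear T"
    by (rule linearI) (auto simp: vec8_eq_iff_8 T_coord add_divide_distrib diff_divide_distrib right_diff_distrib)
  have "lattice_code_optimal_unique L"
  \<comment> \<open>\<open>?a - ?b\<close> realises the second squared norm 6 and is the longest
    difference within \<open>P\<close>. \<open>T\<close> sends \<open>?a\<close> to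
    \<open>- ?w\<close>, so the images of \<open>G\<close> represent the origin and both hole
    classes.\<close>
  proof (rule lattice_code_theorem[where n = 3 and \<rho> = "2/3" and \<sigma> = 6 and u = ?a and v = "?a - ?b"
        and P = "{0, ?a, ?b, ?c}" and T = T and s = "-3" and G = "{0, ?a, - ?a}"])
    fix z assume z: "z \<in> L" "z \<noteq> 0"
    then obtain a b where ab: "coord z 0 = of_int a" "coord z 1 = of_int b"
      unfolding mem by (auto elim!: Ints_cases)
    then have nz: "a \<noteq> 0 \<or> b \<noteq> 0" using z by (auto simp: mem vec8_eq_iff_8)
    define q where "q = a\<^sup>2 + a * b + b\<^sup>2"
    have n: "(norm z)\<^sup>2 = 2 * of_int q"
      using normL[OF z(1)] ab by (simp add: q_def)
    show "2 \<le> (norm z)\<^sup>2" using A2_form_ge(1)[OF nz, folded q_def] n by simp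
    assume "(norm z)\<^sup>2 \<noteq> 2"
    then have "q \<noteq> 1" using n by auto
    then show "6 \<le> (norm z)\<^sup>2" using A2_form_ge(2)[OF nz, folded q_def] n by simp
  next
    show "\<exists>\<phi>. torus_isometry L \<phi> \<and> C' \<subseteq> \<phi> ` C"
      if "separated L (sqrt (2/3)) C" "finite C" "card C = 3" "separated L (sqrt (2/3)) C'" for C C'
      by (rule separated_embedding_few_holes[OF _ _ hole that]) (auto simp: card_insert_if)
  next
    show "(norm y)\<^sup>2 \<le> 2/3" if "y \<in> span L" "shortest L y" for y
    proof -
      have "X \<le> 1 \<Longrightarrow> 2/3 * X \<le> 2/3" for X :: real by linarith
      then show ?thesis using hexagon_bound(1) bound[OF that] norm'[OF that(1)] by metis
    qed
  next
    have "distinct [0, ?a, ?b, ?c]" by (auto simp: vec8_eq_iff_8)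
    from distinct_card[OF this] show "3 < card {0, ?a, ?b, ?c}" by simp
    have "distinct [0, ?a, - ?a]" by (auto simp: vec8_eq_iff_8)
    from distinct_card[OF this] show "card {0, ?a, - ?a} = 3" by simp
    show "\<And>p q. p \<in> {0, ?a, ?b, ?c} \<Longrightarrow> q \<in> {0, ?a, ?b, ?c} \<Longrightarrow> 2/3 * (norm (p - q))\<^sup>2 \<le> 4"
      by (auto simp: norm_coord_8)
    show "2 * (norm (T x))\<^sup>2 = 2/3 * (norm x)\<^sup>2" if "x \<in> span L" for x
    proof -
      have "(norm (T x))\<^sup>2 = ((coord x 1 - coord x 2)\<^sup>2 + (coord x 2 - coord x 0)\<^sup>2 + (coord x 0 - coord x 1)\<^sup>2) / 9"
        unfolding norm_coord_8 by (simp add: T_coord power_divide add_divide_distrib)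
      then show ?thesis
        unfolding norm[OF that] spanL[OF that, THEN conjunct1]
        by (simp only:) (simp add: power2_eq_square algebra_simps)
    qed
    show "-3 *\<^sub>R T l \<in> L" if "l \<in> L" for l
      using that by (auto simp: mem T_coord add_divide_distrib diff_divide_distrib)
    show "T (-3 *\<^sub>R T l) = l" if "l \<in> L" for l
      using that by (auto simp: mem T_coord vec8_eq_iff_8 add_divide_distrib diff_divide_distrib)
    show "x = y" if "x \<in> {0, ?a, - ?a}" "y \<in> {0, ?a, - ?a}" "T (x - y) \<in> L" for x y
    proof -
      have "t \<notin> \<int>" if "0 < t" "t < 1" for t :: real using that by (auto elim!: Ints_cases)
      from this[of "1/3"] this[of "2/3"] show ?thesis using that by (auto simp: mem T_coord)
    qed
  qed (use r dim upper linT in \<open>auto simp: mem norm_coord_8\<close>)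
  then show ?thesis by (simp add: L_def)
qed

section \<open>The lattice \<open>D_4\<close>\<close>

lemma span_D4:
  assumes "y \<in> span D4_lattice"
  shows "coord y 4 = 0 \<and> coord y 5 = 0 \<and> coord y 6 = 0 \<and> coord y 7 = 0" (is "?P y")
proof -
  have "span D4_lattice \<subseteq> {y. ?P y}"
    by (rule span_minimal) (auto simp: mem_D4 subspace_def)
  then show ?thesis using assms by blast
qed

text \<open>These are the absolute coordinates in the Voronoi cell of D_4, a 24-cell. If no entry
  exceeds 1/2, each square is at most 1/4. An entry m > 1/2 forces the other three to be at most 1 -
  m, and m^2 + 3 (1 - m)^2 = 1 + 2 (2 m - 1) (m - 1) is at most 1, with equality only for m =
  1.\<close>

lemma pair_bound_4:
  fixes b :: "nat \<Rightarrow> real"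
  assumes nonneg: "\<And>k. k < 4 \<Longrightarrow> 0 \<le> b k"
    and pair: "\<And>j k. j < 4 \<Longrightarrow> k < 4 \<Longrightarrow> j \<noteq> k \<Longrightarrow> b j + b k \<le> 1"
  shows "(\<Sum>k<4. (b k)\<^sup>2) \<le> 1"
    and "1 \<le> (\<Sum>k<4. (b k)\<^sup>2) \<Longrightarrow>
      (\<forall>k<4. b k = 1/2) \<or> (\<exists>j<4. b j = 1 \<and> (\<forall>k<4. k \<noteq> j \<longrightarrow> b k = 0))"
proof -
  have "(\<Sum>k<4. (b k)\<^sup>2) \<le> 1 \<and> (1 \<le> (\<Sum>k<4. (b k)\<^sup>2) \<longrightarrow>
      (\<forall>k<4. b k = 1/2) \<or> (\<exists>j<4. b j = 1 \<and> (\<forall>k<4. k \<noteq> j \<longrightarrow> b k = 0)))"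
  proof (cases "\<exists>j<4. 1/2 < b j")
    case False
    have le: "(b k)\<^sup>2 \<le> 1/4" if "k < 4" for k
    proof -
      have "b k \<le> 1/2" using False that by (meson not_less)
      then show ?thesis using power_mono[of "b k" "1/2" 2] nonneg[OF that] by (simp add: power_divide)
    qed
    have eq: "(\<Sum>k<4. 1/4 - (b k)\<^sup>2) = 1 - (\<Sum>k<4. (b k)\<^sup>2)" by (simp add: sum_subtractf)
    have ge: "0 \<le> (\<Sum>k<4. 1/4 - (b k)\<^sup>2)" using le by (intro sum_nonneg) auto
    have "\<forall>k<4. b k = 1/2" if "1 \<le> (\<Sum>k<4. (b k)\<^sup>2)"
    proof -
      have "(\<Sum>k<4. 1/4 - (b k)\<^sup>2) = 0" using that eq ge by linarith
      then have "\<forall>k\<in>{..<4}. 1/4 - (b k)\<^sup>2 = 0"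
        using le by (subst (asm) sum_nonneg_eq_0_iff) auto
      then have "(b k)\<^sup>2 = (1/2)\<^sup>2" if "k < 4" for k using that by (auto simp: power2_eq_square)
      then show ?thesis using nonneg by (metis power2_eq_imp_eq zero_le_divide_1_iff zero_le_numeral)
    qed
    moreover have "(\<Sum>k<4. (b k)\<^sup>2) \<le> 1" using eq ge by linarith
    ultimately show ?thesis by blast
  next
    case True
    then obtain j where j: "j < 4" "1/2 < b j" by blast
    let ?m = "b j"
    have le: "0 \<le> b k \<and> b k \<le> 1 - ?m" if "k < 4" "k \<noteq> j" for k
      using nonneg[of k] pair[of k j] that j by auto
    obtain i :: nat where "i < 4" "i \<noteq> j" by (metis less_numeral_extra(1) zero_less_numeral one_less_numeral_iff semiring_norm(76) zero_neq_one)
    then have m1: "?m \<le> 1" using le[of i] by linarith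
    have split: "(\<Sum>k<4. (b k)\<^sup>2) = ?m\<^sup>2 + (\<Sum>k\<in>{..<4} - {j}. (b k)\<^sup>2)"
      using j by (subst sum.remove[of _ j]) auto
    have "(\<Sum>k\<in>{..<4} - {j}. (b k)\<^sup>2) \<le> (\<Sum>k\<in>{..<4} - {j}. (1 - ?m)\<^sup>2)"
      using le by (intro sum_mono power_mono) auto
    also have "\<dots> = 3 * (1 - ?m)\<^sup>2" using j by simp
    finally have le2: "(\<Sum>k<4. (b k)\<^sup>2) \<le> 1 + 2 * (2 * ?m - 1) * (?m - 1)"
      unfolding split by (simp add: power2_eq_square algebra_simps)
    have np: "2 * (2 * ?m - 1) * (?m - 1) \<le> 0" using j m1 by (intro mult_nonneg_nonpos) auto
    have "?m = 1 \<and> (\<forall>k<4. k \<noteq> j \<longrightarrow> b k = 0)" if "1 \<le> (\<Sum>k<4. (b k)\<^sup>2)"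
    proof -
      have "2 * (2 * ?m - 1) * (?m - 1) = 0" using le2 np that by linarith
      then have "?m = 1" using j by auto
      then show ?thesis using le by force
    qed
    then show ?thesis using le2 np j by (meson add_le_same_cancel1 order_trans)
  qed
  then show "(\<Sum>k<4. (b k)\<^sup>2) \<le> 1" "1 \<le> (\<Sum>k<4. (b k)\<^sup>2) \<Longrightarrow>
      (\<forall>k<4. b k = 1/2) \<or> (\<exists>j<4. b j = 1 \<and> (\<forall>k<4. k \<noteq> j \<longrightarrow> b k = 0))"
    by blast+
qed

theorem D4_codes: "lattice_code_optimal_unique D4_lattice"
proof -
  define L where "L = D4_lattice"
  note mem = mem_D4[folded L_def] and spanL = span_D4[folded L_def]
  interpret half_integral_lattice L unfolding L_def by (rule half_integral_D4)
  \<comment> \<open>\<open>e8 0\<close>, \<open>?h\<close> and \<open>?h'\<close> represent the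
    nonzero classes of the dual lattice modulo D_4, which are the deep holes.\<close>
  let ?a = "lvec [1, 1]" and ?b = "lvec [1, -1]" and ?c = "lvec [1, 0, 1]" and ?d = "lvec [1, 0, -1]"
    and ?g = "lvec [2, 1, 1]" and ?h = "lvec [1/2, 1/2, 1/2, 1/2]" and ?h' = "lvec [-1/2, 1/2, 1/2, 1/2]"
  \<comment> \<open>On each pair of coordinates half a Hadamard matrix: the ratio is 1 / sqrt 2 and
    \<open>T\<close> applied twice is multiplication by 1/2, so \<open>s = 2\<close>.\<close>
  define T where "T x = lvec [(coord x 0 + coord x 1) / 2, (coord x 0 - coord x 1) / 2,
    (coord x 2 + coord x 3) / 2, (coord x 2 - coord x 3) / 2]" for x
  have T_coord: "coord (T x) 0 = (coord x 0 + coord x 1) / 2" "coord (T x) (Suc 0) = (coord x 0 - coord x 1) / 2"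
    "coord (T x) 2 = (coord x 2 + coord x 3) / 2" "coord (T x) 3 = (coord x 2 - coord x 3) / 2"
    "coord (T x) 4 = 0" "coord (T x) 5 = 0" "coord (T x) 6 = 0" "coord (T x) 7 = 0" for x
    by (simp_all add: T_def)
  have roots: "s *\<^sub>R e8 j + t *\<^sub>R e8 k \<in> L"
    if "j < 4" "k < 4" "s = 1 \<or> s = -1" "t = 1 \<or> t = -1" for j k s t
  proof -
    have "(\<Sum>i<4. coord (s *\<^sub>R e8 j + t *\<^sub>R e8 k) i) = s + t"
      using that(1,2) by (simp add: sum.distrib sum_coord_e8 flip: sum_distrib_left)
    then show ?thesis
      using that unfolding L_def D4_lattice_def ex_even_iff by auto
  qed
  have norm: "(norm y)\<^sup>2 = (\<Sum>k<4. \<bar>coord y k\<bar>\<^sup>2)" if "y \<in> span L" for y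
    using spanL[OF that] unfolding norm_coord_8 sum_4 by simp
  have pair: "\<bar>coord y j\<bar> + \<bar>coord y k\<bar> \<le> 1" if "shortest L y" "j < 4" "k < 4" "j \<noteq> k" for y j k
    using that roots by (intro shortest_pair) auto
  have hole: "tcoset L x \<in> {tcoset L (e8 0), tcoset L ?h, tcoset L ?h'}"
    if x: "x \<in> span L" "\<forall>l\<in>L. sqrt 1 \<le> norm (x - l)" for x
  proof -
    obtain y where y: "y \<in> span L" "shortest L y" "1 \<le> (norm y)\<^sup>2" "tcoset L x = tcoset L y"
      using hole_by_shortest[OF x] by blast
    have "1 \<le> (\<Sum>k<4. \<bar>coord y k\<bar>\<^sup>2)" using y(3) norm[OF y(1)] by simp
    then consider "\<forall>k<4. \<bar>coord y k\<bar> = 1/2"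
      | j where "j < 4" "\<bar>coord y j\<bar> = 1" "\<forall>k<4. k \<noteq> j \<longrightarrow> \<bar>coord y k\<bar> = 0"
      using pair_bound_4(2)[of "\<lambda>k. \<bar>coord y k\<bar>", OF _ pair[OF y(2)]] by auto
    then have "y - e8 0 \<in> L \<or> y - ?h \<in> L \<or> y - ?h' \<in> L"
    proof cases
      case 1
      have int: "coord y k - 1/2 \<in> \<int>" if "k < 4" for k
      proof -
        have "coord y k - 1/2 = 0 \<or> coord y k - 1/2 = -1" using 1 that by (auto simp: abs_if split: if_splits)
        then show ?thesis by (metis Ints_0 Ints_1 Ints_minus)
      qed
      \<comment> \<open>The parity of \<open>?s\<close> splits the sixteen half-integral vertices
        into the classes of \<open>?h\<close> and \<open>?h'\<close>, which differ by a unit in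
        coordinate 0.\<close>
      let ?s = "(coord y 0 - 1/2) + (coord y 1 - 1/2) + (coord y 2 - 1/2) + (coord y 3 - 1/2)"
      have "?s \<in> \<int>" by (intro Ints_add int) auto
      then have "?s / 2 \<in> \<int> \<or> (?s + 1) / 2 \<in> \<int>" by (rule Ints_half_cases)
      moreover have "?s + 1 = (coord y 0 + 1/2) + (coord y 1 - 1/2) + (coord y 2 - 1/2) + (coord y 3 - 1/2)"
        by simp
      moreover have "coord y 0 + 1/2 \<in> \<int>"
        using Ints_add[OF int[of 0] Ints_1] by (simp add: add.commute)
      ultimately have "y - ?h \<in> L \<or> y - ?h' \<in> L"
        using int[of 0] int[of 1] int[of 2] int[of 3] spanL[OF y(1)]
        unfolding mem coord_diff by simp
      then show ?thesis by blast
    next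
      case 2
      then have "j = 0 \<or> j = 1 \<or> j = 2 \<or> j = 3" by linarith
      moreover have "coord y j = 1 \<or> coord y j = -1" using 2(2) by linarith
      ultimately have "y - e8 0 \<in> L"
        using 2(3)[rule_format, of 0] 2(3)[rule_format, of 1] 2(3)[rule_format, of 2]
          2(3)[rule_format, of 3] spanL[OF y(1)] by (auto simp: mem)
      then show ?thesis by blast
    qed
    then have "tcoset L y = tcoset L (e8 0) \<or> tcoset L y = tcoset L ?h \<or> tcoset L y = tcoset L ?h'"
      by (simp only: tcoset_eq_iff)
    then show ?thesis using y(4) by auto
  qed
  have r: "?a \<in> L" "?b \<in> L" "?c \<in> L" "?d \<in> L" "?g \<in> L" by (auto simp: mem)
  have dim: "dim L = 4"
  proof -
    have "x \<in> span (e8 ` {..<4})" if "x \<in> L" for x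
    proof -
      have "x = (\<Sum>k<4. coord x k *\<^sub>R e8 k)"
        using that by (auto simp: vec8_eq_iff_8 mem sum_4)
      then show ?thesis by (metis (no_types, lifting) imageI span_base span_scale span_sum)
    qed
    moreover have "e8 k \<in> span L" if "k < 4" for k
    proof -
      obtain j :: nat where "j < 4" "j \<noteq> k" by (metis zero_less_numeral one_less_numeral_iff semiring_norm(76) zero_neq_one)
      then have "(1/2) *\<^sub>R ((1 *\<^sub>R e8 k + 1 *\<^sub>R e8 j) + (1 *\<^sub>R e8 k + (-1) *\<^sub>R e8 j)) \<in> span L"
        using that by (intro span_scale span_add[of _ L] span_base roots) auto
      then show ?thesis by (simp add: scaleR_add_right flip: scaleR_left.add)
    qed
    ultimately have "span L = span (e8 ` {..<4})" by (intro span_eq[THEN iffD2]) auto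
    moreover have "independent (e8 ` {..<4})"
      using e8_Basis by (intro independent_mono[OF independent_Basis]) auto
    moreover have "inj_on e8 {..<4}"
    proof (rule inj_onI)
      fix i j :: nat assume "i \<in> {..<4}" "j \<in> {..<4}" "e8 i = e8 j"
      then show "i = j" using coord_e8[of i i] coord_e8[of i j] by (auto split: if_splits)
    qed
    ultimately show ?thesis by (metis card_image card_lessThan dim_eq_card)
  qed
  have even: "(norm z)\<^sup>2 / 2 \<in> \<int>" if z: "z \<in> L" for z
  proof -
    have "(norm z)\<^sup>2 / 2 = (\<Sum>k<4. (coord z k)\<^sup>2 + coord z k) / 2 - (\<Sum>k<4. coord z k) / 2"
      using norm[OF span_base[OF z]] by (simp add: sum.distrib add_divide_distrib)
    also have "\<dots> \<in> \<int>"
      using z unfolding L_def D4_lattice_def ex_even_iff by (intro Ints_diff sum_squares_even) auto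
    finally show ?thesis .
  qed
  have upper: "finite C \<and> card C \<le> 4" if "separated L (sqrt 1) C" "tcoset L 0 \<in> C" for C
    by (rule separated_card_few_holes[OF _ _ hole that]) (simp_all add: card_insert_if)
  have linT: "linear T"
    by (rule linearI) (auto simp: vec8_eq_iff_8 T_coord field_simps)
  have "lattice_code_optimal_unique L"
  \<comment> \<open>\<open>T\<close> sends \<open>?a\<close>, \<open>?c\<close>, \<open>?g\<close>
    into the classes of \<open>e8 0\<close>, \<open>?h\<close>, \<open>?h'\<close>. The longest
    differences in \<open>P\<close>, such as \<open>?a - ?b\<close>, are twice a unit
    vector.\<close>
  proof (rule lattice_code_theorem[where n = 4 and \<rho> = 1 and \<sigma> = 4 and u = ?a and v = "?a + ?b"
        and P = "{0, ?a, ?b, ?c, ?d}" and T = T and s = 2 and G = "{0, ?a, ?c, ?g}"])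
    fix z assume z: "z \<in> L" "z \<noteq> 0"
    then show "2 \<le> (norm z)\<^sup>2" "(norm z)\<^sup>2 \<noteq> 2 \<Longrightarrow> 4 \<le> (norm z)\<^sup>2"
      using even_pos_ge[OF even[OF z(1)]] by auto
  next
    show "\<exists>\<phi>. torus_isometry L \<phi> \<and> C' \<subseteq> \<phi> ` C"
      if "separated L (sqrt 1) C" "finite C" "card C = 4" "separated L (sqrt 1) C'" for C C'
      by (rule separated_embedding_few_holes[OF _ _ hole that]) (auto simp: card_insert_if)
  next
    show "(norm y)\<^sup>2 \<le> 1" if "y \<in> span L" "shortest L y" for y
      using pair_bound_4(1)[of "\<lambda>k. \<bar>coord y k\<bar>", OF _ pair[OF that(2)]] norm[OF that(1)] by auto
  next
    have "distinct [0, ?a, ?b, ?c, ?d]" by (auto simp: vec8_eq_iff_8)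
    from distinct_card[OF this] show "4 < card {0, ?a, ?b, ?c, ?d}" by simp
    have "distinct [0, ?a, ?c, ?g]" by (auto simp: vec8_eq_iff_8)
    from distinct_card[OF this] show "card {0, ?a, ?c, ?g} = 4" by simp
    show "\<And>p q. p \<in> {0, ?a, ?b, ?c, ?d} \<Longrightarrow> q \<in> {0, ?a, ?b, ?c, ?d} \<Longrightarrow> 1 * (norm (p - q))\<^sup>2 \<le> 4"
      by (auto simp: norm_coord_8)
    show "2 * (norm (T x))\<^sup>2 = 1 * (norm x)\<^sup>2" if "x \<in> span L" for x
      using spanL[OF that] unfolding norm_coord_8
      by (simp add: T_coord) (simp add: power2_eq_square field_simps)
    show "2 *\<^sub>R T l \<in> L" if "l \<in> L" for l
    proof -
      have "2 *\<^sub>R T l = lvec [coord l 0 + coord l 1, coord l 0 - coord l 1, coord l 2 + coord l 3,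
          coord l 2 - coord l 3]" (is "_ = ?m")
        by (simp add: vec8_eq_iff_8 T_coord)
      then show ?thesis using that unfolding mem by (simp add: add_divide_distrib)
    qed
    show "T (2 *\<^sub>R T l) = l" if "l \<in> L" for l
      using that by (auto simp: mem T_coord vec8_eq_iff_8 add_divide_distrib diff_divide_distrib)
    show "x = y" if "x \<in> {0, ?a, ?c, ?g}" "y \<in> {0, ?a, ?c, ?g}" "T (x - y) \<in> L" for x y
      using that half_notin_Ints by (auto simp: mem T_coord)
    show "sqrt (4 / 2) ^ dim L = real 4"
      using power_mult[of "sqrt 2" 2 2] by (simp add: dim)
  qed (use r dim upper linT in \<open>auto simp: mem norm_coord_8\<close>)
  then show ?thesis by (simp add: L_def)
qed

section \<open>The lattice \<open>E_8\<close>\<close>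

lemma mem_E8: "x \<in> E8_lattice \<longleftrightarrow>
  ((\<forall>k<8. coord x k \<in> \<int>) \<or> (\<forall>k<8. coord x k - 1/2 \<in> \<int>)) \<and> (\<Sum>k<8. coord x k) / 2 \<in> \<int>"
  unfolding E8_lattice_def mem_Collect_eq ex_even_iff ..

lemma half_integral_E8: "half_integral_lattice E8_lattice"
proof
  show "0 \<in> E8_lattice" by (simp add: mem_E8)
next
  fix x y assume x: "x \<in> E8_lattice" and y: "y \<in> E8_lattice"
  have "(\<Sum>k<8. coord (x - y) k) / 2 = (\<Sum>k<8. coord x k) / 2 - (\<Sum>k<8. coord y k) / 2"
    by (simp add: sum_subtractf diff_divide_distrib)
  also have "\<dots> \<in> \<int>" using x y unfolding mem_E8 by (intro Ints_diff) blast+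
  finally have sum: "(\<Sum>k<8. coord (x - y) k) / 2 \<in> \<int>" .
  have a: "a - b \<in> \<int>" if "a - 1/2 \<in> \<int>" "b - 1/2 \<in> \<int>" for a b :: real
    using Ints_diff[OF that] by simp
  have b: "a - b - 1/2 \<in> \<int>" if "a - 1/2 \<in> \<int>" "b \<in> \<int>" for a b :: real
    using Ints_diff[OF that] by (simp add: algebra_simps)
  have c: "a - b - 1/2 \<in> \<int>" if "a \<in> \<int>" "b - 1/2 \<in> \<int>" for a b :: real
    using Ints_diff[OF Ints_diff[OF that] Ints_1] by (simp add: algebra_simps)
  show "x - y \<in> E8_lattice"
    using x y sum unfolding mem_E8[of x] mem_E8[of y] unfolding mem_E8[of "x - y"] coord_diff
    by (auto intro: a b c Ints_diff)
next
  fix z k assume "z \<in> E8_lattice" "k < (8::nat)"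
  then consider "coord z k \<in> \<int>" | "coord z k - 1/2 \<in> \<int>" by (auto simp: mem_E8)
  then show "2 * coord z k \<in> \<int>"
  proof cases
    case 2
    have "2 * coord z k = 2 * (coord z k - 1/2) + 1" by simp
    also have "\<dots> \<in> \<int>" using 2 by (intro Ints_add Ints_mult) auto
    finally show ?thesis .
  qed auto
qed

interpretation E8: half_integral_lattice E8_lattice
  by (rule half_integral_E8)

lemma E8_even:
  assumes z: "z \<in> E8_lattice"
  shows "(norm z)\<^sup>2 / 2 \<in> \<int>"
proof -
  from z consider "\<forall>k<8. coord z k \<in> \<int>" | "\<forall>k<8. coord z k - 1/2 \<in> \<int>" by (auto simp: mem_E8)
  then show ?thesis
  proof cases
    case 1
    have "(norm z)\<^sup>2 / 2 = (\<Sum>k<8. (coord z k)\<^sup>2 + coord z k) / 2 - (\<Sum>k<8. coord z k) / 2"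
      unfolding norm_coord by (simp add: sum.distrib add_divide_distrib)
    also have "\<dots> \<in> \<int>"
      using z 1 unfolding mem_E8 by (intro Ints_diff sum_squares_even) auto
    finally show ?thesis .
  next
    case 2
    \<comment> \<open>A half-integral square exceeds an even integer by 1/4, and the eight quarters
      add up to 2.\<close>
    have "(coord z k)\<^sup>2 = ((coord z k - 1/2)\<^sup>2 + (coord z k - 1/2)) + 1/4" for k
      by (simp add: power2_eq_square algebra_simps)
    then have "(norm z)\<^sup>2 = (\<Sum>k<8. ((coord z k - 1/2)\<^sup>2 + (coord z k - 1/2)) + 1/4)"
      unfolding norm_coord by presburger
    also have "\<dots> / 2 = (\<Sum>k<8. (coord z k - 1/2)\<^sup>2 + (coord z k - 1/2)) / 2 + 1"
      unfolding sum.distrib[of _ "\<lambda>_. 1/4"] by simp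
    also have "\<dots> \<in> \<int>"
      using 2 by (intro Ints_add sum_squares_even) auto
    finally show ?thesis .
  qed
qed

lemma E8_inner:
  assumes "x \<in> E8_lattice" "y \<in> E8_lattice"
  shows "x \<bullet> y \<in> \<int>"
proof -
  have "x \<bullet> y = (norm (x + y))\<^sup>2 / 2 - (norm x)\<^sup>2 / 2 - (norm y)\<^sup>2 / 2"
    by (simp add: power2_norm_eq_inner inner_add_left inner_add_right inner_commute field_simps)
  also have "\<dots> \<in> \<int>" using assms by (intro Ints_diff E8_even E8.add_mem)
  finally show ?thesis .
qed

lemma E8_norm_ge:
  assumes "z \<in> E8_lattice" "z \<noteq> 0"
  shows "2 \<le> (norm z)\<^sup>2" and "(norm z)\<^sup>2 \<noteq> 2 \<Longrightarrow> 4 \<le> (norm z)\<^sup>2"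
  using even_pos_ge[OF E8_even[OF assms(1)]] assms(2) by auto

section \<open>Roots and the Voronoi cell of E_8\<close>

lemma E8_pair_root:
  assumes "j < 8" "k < 8" "s = 1 \<or> s = -1" "t = 1 \<or> t = -1"
  shows "s *\<^sub>R e8 j + t *\<^sub>R e8 k \<in> E8_lattice"
proof -
  have "(\<Sum>i<8. coord (s *\<^sub>R e8 j + t *\<^sub>R e8 k) i) = s + t"
    using assms(1,2) by (simp add: sum.distrib sum_coord_e8 flip: sum_distrib_left)
  then show ?thesis using assms(3,4) unfolding mem_E8 by auto
qed

text \<open>The condition on the sum makes the number of minus signs even: with N of them the sum is
  8 - 2 N.\<close>

lemma E8_spinor_root:
  assumes \<epsilon>: "\<And>k. k < 8 \<Longrightarrow> \<epsilon> k = 1 \<or> \<epsilon> k = -1" and sum: "(\<Sum>k<8. \<epsilon> k) / 4 \<in> \<int>"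
  shows "vec8 (\<lambda>k. \<epsilon> k / 2) \<in> E8_lattice" and "(norm (vec8 (\<lambda>k. \<epsilon> k / 2)))\<^sup>2 = 2"
    and "y \<bullet> vec8 (\<lambda>k. \<epsilon> k / 2) = (\<Sum>k<8. \<epsilon> k * coord y k) / 2"
proof -
  let ?v = "vec8 (\<lambda>k. \<epsilon> k / 2)"
  have "coord ?v k - 1/2 \<in> \<int>" if "k < 8" for k
    using \<epsilon>[OF that] that by auto
  moreover have "(\<Sum>k<8. coord ?v k) / 2 = (\<Sum>k<8. \<epsilon> k) / 4"
    by (simp flip: sum_divide_distrib)
  ultimately show "?v \<in> E8_lattice" using sum unfolding mem_E8 by metis
  have "(coord ?v k)\<^sup>2 = 1/4" if "k < 8" for k
    using \<epsilon>[OF that] that by (auto simp: power2_eq_square)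
  then have "(norm ?v)\<^sup>2 = (\<Sum>k<(8::nat). 1/4)" unfolding norm_coord by (intro sum.cong) auto
  then show "(norm ?v)\<^sup>2 = 2" by simp
  show "y \<bullet> ?v = (\<Sum>k<8. \<epsilon> k * coord y k) / 2"
    unfolding inner_coord sum_divide_distrib by (intro sum.cong) auto
qed

text \<open>The bound in the second case is \<open>1 + (2t - 1)(t - 1)\<close> with \<open>t = \<mu> + b j\<close> between 1/2 and 1.\<close>

lemma E8_cell_bound:
  fixes b :: "nat \<Rightarrow> real" and \<mu> :: real
  assumes \<mu>: "0 \<le> \<mu>" "\<And>k. k < 8 \<Longrightarrow> \<mu> \<le> b k" and S: "(\<Sum>k<8. b k) \<le> 2 + 2 * \<mu>"
    and pair: "\<And>j k. j < 8 \<Longrightarrow> k < 8 \<Longrightarrow> j \<noteq> k \<Longrightarrow> b j + b k \<le> 1"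
  shows "(\<Sum>k<8. (b k)\<^sup>2) \<le> 1 \<and> (1 \<le> (\<Sum>k<8. (b k)\<^sup>2) \<longrightarrow>
    (\<forall>k<8. b k = 0 \<or> b k = 1/2) \<and> (\<Sum>k<8. b k) = 2 \<or>
    (\<exists>j<8. b j = 1 \<and> (\<forall>k<8. k \<noteq> j \<longrightarrow> b k = 0)) \<or>
    \<mu> = 1/4 \<and> (\<exists>j<8. b j = 3/4 \<and> (\<forall>k<8. k \<noteq> j \<longrightarrow> b k = 1/4)))"
proof (cases "\<exists>j<8. 1/2 < b j")
  case False
  define S Q where "S = (\<Sum>k<8. b k)" and "Q = (\<Sum>k<8. (b k)\<^sup>2)"
  have b: "\<mu> \<le> b k \<and> b k \<le> 1/2" if "k < 8" for k using \<mu>(2) that False by (meson not_less)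
  \<comment> \<open>Entries between \<open>\<mu>\<close> and 1/2 make this product nonnegative;
    summation bounds the squares by the linear sum, which is controlled by hypothesis.\<close>
  have gap: "0 \<le> (b k - \<mu>) * (1/2 - b k)" if "k < 8" for k using b[OF that] by simp
  have sum_gap: "(\<Sum>k<8. (b k - \<mu>) * (1/2 - b k)) = (\<mu> + 1/2) * S - Q - 4 * \<mu>"
  proof -
    have "(b k - \<mu>) * (1/2 - b k) = (\<mu> + 1/2) * b k - (b k)\<^sup>2 - \<mu> / 2" for k
      by (simp add: power2_eq_square field_simps)
    then show ?thesis unfolding S_def Q_def by (simp add: sum_subtractf sum_distrib_left)
  qed
  have ge: "0 \<le> (\<Sum>k<8. (b k - \<mu>) * (1/2 - b k))" using gap by (intro sum_nonneg) auto
  have S2: "S \<le> 2 + 2 * \<mu>" using S by (simp add: S_def)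
  \<comment> \<open>Eight entries of at least \<open>\<mu>\<close> against the total
    \<open>2 + 2 * \<mu>\<close> keep \<open>\<mu>\<close> below 1/2, so that the extreme case can
    only come from \<open>\<mu> = 0\<close>.\<close>
  have "(\<Sum>k<(8::nat). \<mu>) \<le> S" unfolding S_def using \<mu>(2) by (intro sum_mono) auto
  then have \<mu>3: "\<mu> \<le> 1/3" using S2 by simp
  have "(\<mu> + 1/2) * S \<le> (\<mu> + 1/2) * (2 + 2 * \<mu>)" using S2 \<mu> by (intro mult_left_mono) auto
  then have Q: "Q \<le> 1 - \<mu> * (1 - 2 * \<mu>)" using sum_gap ge by (simp add: algebra_simps)
  have np: "0 \<le> \<mu> * (1 - 2 * \<mu>)" using \<mu> \<mu>3 by (intro mult_nonneg_nonneg) auto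
  have "(\<forall>k<8. b k = 0 \<or> b k = 1/2) \<and> S = 2" if "1 \<le> Q"
  proof -
    have "\<mu> * (1 - 2 * \<mu>) = 0" using Q np that by linarith
    then have 0: "\<mu> = 0" using \<mu>3 by auto
    then have "S = 2" using sum_gap ge S2 that by simp
    moreover have "(\<Sum>k<8. (b k - \<mu>) * (1/2 - b k)) = 0" using 0 sum_gap ge S2 that by simp
    then have "\<forall>k\<in>{..<8}. (b k - \<mu>) * (1/2 - b k) = 0"
      using gap by (subst (asm) sum_nonneg_eq_0_iff) auto
    ultimately show ?thesis using 0 by auto
  qed
  moreover have "Q \<le> 1" using Q np by linarith
  ultimately show ?thesis unfolding S_def Q_def by blast
next
  case True
  then obtain j where j: "j < 8" "1/2 < b j" by blast
  define J where "J = {..<8} - {j}"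
  define m t where "m = b j" and "t = \<mu> + m"
  define S Q where "S = (\<Sum>k\<in>J. b k)" and "Q = (\<Sum>k\<in>J. (b k)\<^sup>2)"
  have fin: "finite J" "card J = 7" using j by (auto simp: J_def)
  have split: "(\<Sum>k<8. f k) = f j + sum f J" for f :: "nat \<Rightarrow> real"
    unfolding J_def using j by (intro sum.remove) auto
  have b: "\<mu> \<le> b k \<and> b k \<le> 1 - m" if "k \<in> J" for k
    using \<mu>(2)[of k] pair[of k j] that j by (auto simp: J_def m_def)
  obtain i where "i \<in> J" using fin by fastforce
  then have t: "1/2 < t" "t \<le> 1" using b[of i] j \<mu> by (auto simp: t_def m_def)
  \<comment> \<open>The same product argument on the seven other entries, now confined between
    \<open>\<mu>\<close> and \<open>1 - m\<close>.\<close>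
  have "0 \<le> (\<Sum>k\<in>J. (b k - \<mu>) * (1 - m - b k))"
    using b by (intro sum_nonneg mult_nonneg_nonneg) auto
  also have "(\<Sum>k\<in>J. (b k - \<mu>) * (1 - m - b k)) = (\<mu> + 1 - m) * S - Q - 7 * (\<mu> * (1 - m))"
  proof -
    have "(b k - \<mu>) * (1 - m - b k) = (\<mu> + 1 - m) * b k - (b k)\<^sup>2 - \<mu> * (1 - m)" for k
      by (simp add: power2_eq_square algebra_simps)
    then show ?thesis unfolding S_def Q_def by (simp add: sum_subtractf sum_distrib_left fin)
  qed
  finally have Q: "Q \<le> (\<mu> + 1 - m) * S - 7 * (\<mu> * (1 - m))" by simp
  have S2: "S \<le> 2 + 2 * \<mu> - m" using S unfolding split by (simp add: S_def m_def)
  have "(\<mu> + 1 - m) * S \<le> (\<mu> + 1 - m) * (2 + 2 * \<mu> - m)"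
    using S2 \<mu> t b[OF \<open>i \<in> J\<close>] by (intro mult_left_mono) auto
  then have Q2: "m\<^sup>2 + Q \<le> 1 + (2 * t - 1) * (t - 1)"
    using Q by (simp add: t_def power2_eq_square algebra_simps)
  have np: "(2 * t - 1) * (t - 1) \<le> 0" using t by (intro mult_nonneg_nonpos) auto
  have "(\<exists>j<8. b j = 1 \<and> (\<forall>k<8. k \<noteq> j \<longrightarrow> b k = 0)) \<or>
      \<mu> = 1/4 \<and> (\<exists>j<8. b j = 3/4 \<and> (\<forall>k<8. k \<noteq> j \<longrightarrow> b k = 1/4))" if 1: "1 \<le> m\<^sup>2 + Q"
  proof -
    have "(2 * t - 1) * (t - 1) = 0" using 1 Q2 np by linarith
    then have "t = 1" using t by auto
    then have m: "m = 1 - \<mu>" by (simp add: t_def)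
    have bk: "b k = \<mu>" if "k \<in> J" for k using b[OF that] m by simp
    then have "S = 7 * \<mu>" "Q = 7 * \<mu>\<^sup>2" by (simp_all add: S_def Q_def fin)
    \<comment> \<open>The linear bound gives one inequality, and the sum of squares being at least 1
      gives the reverse one up to a factor \<open>\<mu>\<close>; this is the origin of the value
      1/4.\<close>
    then have "\<mu> \<le> 1/4" "2 * \<mu> \<le> 8 * \<mu>\<^sup>2"
      using S2 1 m by (simp_all add: power2_eq_square algebra_simps)
    then have "0 \<le> \<mu> * (4 * \<mu> - 1)" "\<mu> * (4 * \<mu> - 1) \<le> 0"
      using mult_nonneg_nonpos[OF \<mu>(1), of "4 * \<mu> - 1"] by (simp_all add: power2_eq_square algebra_simps)
    then have "\<mu> * (4 * \<mu> - 1) = 0" by linarith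
    then have "\<mu> = 0 \<or> \<mu> = 1/4" by auto
    moreover have "\<forall>k<8. k \<noteq> j \<longrightarrow> b k = \<mu>" using bk by (auto simp: J_def)
    moreover have "b j = 1 - \<mu>" using m by (simp add: m_def)
    ultimately show ?thesis
    proof (elim disjE)
      assume "\<mu> = 0" "b j = 1 - \<mu>" "\<forall>k<8. k \<noteq> j \<longrightarrow> b k = \<mu>"
      then show ?thesis using j(1) by (intro disjI1 exI[of _ j]) simp
    next
      assume "\<mu> = 1/4" "b j = 1 - \<mu>" "\<forall>k<8. k \<noteq> j \<longrightarrow> b k = \<mu>"
      then show ?thesis using j(1) by (intro disjI2 conjI exI[of _ j]) simp_all
    qed
  qed
  moreover have "m\<^sup>2 + Q \<le> 1" using Q2 np by linarith
  moreover have "(\<Sum>k<8. (b k)\<^sup>2) = m\<^sup>2 + Q" by (simp add: split m_def Q_def)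
  ultimately show ?thesis by presburger
qed

text \<open>Half-integral roots have an even number of minus signs. If \<open>y\<close> has an odd
  number of negative coordinates, the sign is flipped at an entry of least absolute value, and
  \<open>\<mu>\<close> is that value; otherwise \<open>\<mu> = 0\<close>. In each extreme
  configuration twice \<open>y\<close> has the parity required of E_8.\<close>

lemma E8_shortest:
  assumes y: "shortest E8_lattice y"
  shows "(norm y)\<^sup>2 \<le> 1" and "1 \<le> (norm y)\<^sup>2 \<Longrightarrow> 2 *\<^sub>R y \<in> E8_lattice"
proof -
  define b where "b k = \<bar>coord y k\<bar>" for k
  define sg :: "nat \<Rightarrow> real" where "sg k = (if coord y k < 0 then -1 else 1)" for k
  define N :: real where "N = (\<Sum>k<8. if coord y k < 0 then 1 else 0)"
  have sg: "sg k = 1 \<or> sg k = -1" for k by (auto simp: sg_def)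
  have sgb: "coord y k = sg k * b k" and bsg: "sg k * coord y k = b k" for k by (auto simp: sg_def b_def)
  have "sg k = 1 - 2 * (if coord y k < 0 then 1 else 0)" for k by (auto simp: sg_def)
  then have sum_sg: "(\<Sum>k<8. sg k) = 8 - 2 * N" by (simp add: N_def sum_subtractf sum_distrib_left)
  have NZ: "N \<in> \<int>" unfolding N_def by (intro Ints_sum) auto
  have norm: "(norm y)\<^sup>2 = (\<Sum>k<8. (b k)\<^sup>2)" by (simp add: norm_coord b_def)
  have spinor: "(\<Sum>k<8. \<epsilon> k * coord y k) \<le> 2"
    if "\<And>k. k < 8 \<Longrightarrow> \<epsilon> k = 1 \<or> \<epsilon> k = -1" "(\<Sum>k<8. \<epsilon> k) / 4 \<in> \<int>" for \<epsilon>
    using shortest_inner_le[OF y E8_spinor_root(1)[OF that]] E8_spinor_root(2,3)[OF that] by simp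
  obtain \<mu> where \<mu>: "0 \<le> \<mu>" "\<And>k. k < 8 \<Longrightarrow> \<mu> \<le> b k" "(\<Sum>k<8. b k) \<le> 2 + 2 * \<mu>"
    and odd: "\<mu> = 0 \<or> (N + 1) / 2 \<in> \<int>"
  proof (cases "N / 2 \<in> \<int>")
    case True
    have "(\<Sum>k<8. sg k) / 4 = 2 - N / 2" by (simp add: sum_sg)
    also have "\<dots> \<in> \<int>" using True by (intro Ints_diff) auto
    finally have "(\<Sum>k<8. b k) \<le> 2" using spinor[of sg] sg by (simp add: bsg)
    then show ?thesis using that[of 0] by (simp add: b_def)
  next
    case False
    then have N1: "(N + 1) / 2 \<in> \<int>" using Ints_half_cases[OF NZ] by blast
    obtain i where i: "i < 8" "\<And>k. k < 8 \<Longrightarrow> b i \<le> b k"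
      using ex_is_arg_min_if_finite[of "{..<8::nat}" b] by (auto simp: is_arg_min_linorder lessThan_empty_iff)
    define \<epsilon> where "\<epsilon> k = (if k = i then - sg k else sg k)" for k
    have \<epsilon>: "\<epsilon> k = sg k - (if k = i then 2 * sg i else 0)" for k by (simp add: \<epsilon>_def)
    have "(\<Sum>k<8. \<epsilon> k) = 8 - 2 * N - 2 * sg i"
      unfolding \<epsilon> sum_subtractf sum_sg using i by simp
    then have "(\<Sum>k<8. \<epsilon> k) / 4 = 2 - (N + 1) / 2 + (1 - sg i) / 2" by (simp add: field_simps)
    also have "\<dots> \<in> \<int>" using N1 sg[of i] by (intro Ints_add Ints_diff) auto
    finally have "(\<Sum>k<8. \<epsilon> k * coord y k) \<le> 2" using sg by (intro spinor) (auto simp: \<epsilon>_def)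
    moreover have "\<epsilon> k * coord y k = b k - (if k = i then 2 * b i else 0)" for k
      using bsg[of k] by (auto simp: \<epsilon>_def)
    ultimately have "(\<Sum>k<8. b k) \<le> 2 + 2 * b i" using i by (simp add: sum_subtractf)
    then show ?thesis using that[of "b i"] i N1 by (auto simp: b_def)
  qed
  have pair: "b j + b k \<le> 1" if "j < 8" "k < 8" "j \<noteq> k" for j k
    unfolding b_def using that by (intro shortest_pair[OF y]) (auto intro: E8_pair_root)
  note bound = E8_cell_bound[OF \<mu> pair]
  show "(norm y)\<^sup>2 \<le> 1" using bound norm by simp
  have sum2: "(\<Sum>k<8. coord (2 *\<^sub>R y) k) / 2 = (\<Sum>k<8. coord y k)" by (simp flip: sum_distrib_left)
  assume "1 \<le> (norm y)\<^sup>2"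
  then consider (halves) "\<forall>k<8. b k = 0 \<or> b k = 1/2" "(\<Sum>k<8. b k) = 2"
    | (unit) j where "j < 8" "b j = 1" "\<forall>k<8. k \<noteq> j \<longrightarrow> b k = 0"
    | (quarters) j where "\<mu> = 1/4" "j < 8" "b j = 3/4" "\<forall>k<8. k \<noteq> j \<longrightarrow> b k = 1/4"
    using bound norm by auto
  then show "2 *\<^sub>R y \<in> E8_lattice"
  proof cases
    case halves
    have int: "2 * b k \<in> \<int>" if "k < 8" for k
    proof -
      have "2 * b k = 0 \<or> 2 * b k = 1" using halves(1) that by auto
      then show ?thesis by (metis Ints_0 Ints_1)
    qed
    \<comment> \<open>A minus sign lowers the sum by \<open>2 * b k\<close>, an integer here, so the
      coordinate sum of \<open>y\<close> stays integral.\<close>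
    have "coord y k = b k - (if coord y k < 0 then 2 * b k else 0)" for k by (auto simp: b_def)
    then have "(\<Sum>k<8. coord y k) = 2 - (\<Sum>k<8. if coord y k < 0 then 2 * b k else 0)"
      using halves(2) by (metis (no_types, lifting) sum.cong sum_subtractf)
    also have "\<dots> \<in> \<int>" using int by (intro Ints_diff Ints_sum) auto
    finally have "(\<Sum>k<8. coord (2 *\<^sub>R y) k) / 2 \<in> \<int>" unfolding sum2 .
    moreover have "coord (2 *\<^sub>R y) k \<in> \<int>" if "k < 8" for k
      using int[OF that] sg[of k] by (auto simp: sgb)
    ultimately show ?thesis unfolding mem_E8 by blast
  next
    case unit
    have "coord y k \<in> \<int>" if "k < 8" for k
      using unit that sg[of k] by (cases "k = j") (auto simp: sgb)
    then show ?thesis unfolding mem_E8 sum2 by (auto intro: Ints_sum)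
  next
    case quarters
    have bk: "b k = 1/4 + (if k = j then 1/2 else 0)" if "k < 8" for k using quarters that by auto
    \<comment> \<open>This sum is integral only for odd \<open>N\<close>, which is why
      \<open>odd\<close> is recorded together with \<open>\<mu>\<close>.\<close>
    have "(\<Sum>k<8. coord y k) = (\<Sum>k<8. sg k / 4 + (if k = j then sg j / 2 else 0))"
      using bk by (intro sum.cong) (auto simp: sgb algebra_simps)
    also have "\<dots> = (8 - 2 * N) / 4 + sg j / 2"
      using quarters(2) unfolding sum.distrib by (simp add: sum_sg flip: sum_divide_distrib)
    also have "\<dots> = 2 - (N + 1) / 2 + (1 + sg j) / 2" by (simp add: field_simps)
    also have "\<dots> \<in> \<int>" using quarters(1) odd sg[of j] by (intro Ints_add Ints_diff) auto
    finally have "(\<Sum>k<8. coord (2 *\<^sub>R y) k) / 2 \<in> \<int>" unfolding sum2 .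
    moreover have "coord (2 *\<^sub>R y) k - 1/2 \<in> \<int>" if "k < 8" for k
      using bk[OF that] sg[of k] by (auto simp: sgb)
    ultimately show ?thesis unfolding mem_E8 by blast
  qed
qed

section \<open>Singular vectors of the quadratic space E_8 / 2 E_8\<close>

text \<open>\<open>2 x\<close> represents a singular (possibly zero) vector of the quadratic space \<open>E_8 / 2 E_8\<close>, whose
  form is half the squared norm modulo 2.\<close>

definition E8_good :: "real^8 \<Rightarrow> bool" where
  "E8_good x \<longleftrightarrow> 2 *\<^sub>R x \<in> E8_lattice \<and> (norm x)\<^sup>2 \<in> \<int>"

text \<open>Even squared norms and integral inner products make the form well defined modulo the
  lattice, so representatives of a class can be changed freely.\<close>

lemma E8_good_add:
  assumes "E8_good x" "l \<in> E8_lattice"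
  shows "E8_good (x + l)"
proof -
  have "(norm (x + l))\<^sup>2 = (norm x)\<^sup>2 + (2 *\<^sub>R x) \<bullet> l + 2 * ((norm l)\<^sup>2 / 2)"
    by (simp add: power2_norm_eq_inner inner_add_left inner_add_right inner_commute)
  also have "\<dots> \<in> \<int>"
    using assms by (intro Ints_add Ints_mult E8_inner E8_even) (auto simp: E8_good_def)
  finally show ?thesis
    using assms E8.add_mem[OF _ E8.scale_int_mem[OF assms(2), of 2]]
    by (simp add: E8_good_def scaleR_add_right)
qed

lemma E8_good_mem: "x \<in> E8_lattice \<Longrightarrow> E8_good x"
  using E8_good_add[of 0 x] E8.zero_mem by (simp add: E8_good_def)

lemma E8_good_hole:
  assumes "\<forall>l\<in>E8_lattice. 1 \<le> norm (x - l)"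
  shows "E8_good x"
proof -
  obtain l where l: "l \<in> E8_lattice" "shortest E8_lattice (x - l)" by (rule E8.exists_shortest)
  have "1 \<le> (norm (x - l))\<^sup>2" using assms l by simp
  moreover from this have "(norm (x - l))\<^sup>2 = 1" using E8_shortest(1)[OF l(2)] by simp
  ultimately have "E8_good (x - l)" using E8_shortest(2)[OF l(2)] by (simp add: E8_good_def)
  then show ?thesis using E8_good_add[OF _ l(1)] by fastforce
qed

lemma separated_E8_good:
  assumes C: "separated E8_lattice 1 C" and xy: "tcoset E8_lattice x \<in> C" "tcoset E8_lattice y \<in> C"
  shows "E8_good (x - y)"
proof (cases "x - y \<in> E8_lattice")
  case False
  then have "1 \<le> tdist E8_lattice (tcoset E8_lattice x) (tcoset E8_lattice y)"
    using C xy E8.tcoset_eq_iff unfolding separated_def by metis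
  then show ?thesis unfolding E8.le_tdist_iff by (rule E8_good_hole)
qed (rule E8_good_mem)

text \<open>Polarisation. The quantity is half the inner product of \<open>2 *\<^sub>R x\<close> and
  \<open>2 *\<^sub>R y\<close>, so its integrality is the orthogonality of the two classes.\<close>

lemma E8_good_inner:
  assumes "E8_good x" "E8_good y" "E8_good (x - y)"
  shows "2 * (x \<bullet> y) \<in> \<int>"
proof -
  have "2 * (x \<bullet> y) = (norm x)\<^sup>2 + (norm y)\<^sup>2 - (norm (x - y))\<^sup>2"
    by (simp add: power2_norm_eq_inner inner_diff_left inner_diff_right inner_commute)
  also have "\<dots> \<in> \<int>" using assms by (intro Ints_add Ints_diff) (auto simp: E8_good_def)
  finally show ?thesis .
qed

section \<open>Characters of E_8 / 2 E_8 and the bound 16\<close>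

definition parity_sign :: "real \<Rightarrow> real" where
  "parity_sign t = (if t / 2 \<in> \<int> then 1 else -1)"

lemma parity_sign_add:
  assumes "a \<in> \<int>" "b \<in> \<int>"
  shows "parity_sign (a + b) = parity_sign a * parity_sign b"
proof -
  have even: "(a + b) / 2 \<in> \<int> \<longleftrightarrow> b / 2 \<in> \<int>" if "a / 2 \<in> \<int>" for a b :: real
  proof
    assume "(a + b) / 2 \<in> \<int>"
    from Ints_diff[OF this that] show "b / 2 \<in> \<int>" by (simp add: add_divide_distrib)
  next
    assume "b / 2 \<in> \<int>"
    from Ints_add[OF that this] show "(a + b) / 2 \<in> \<int>" by (simp add: add_divide_distrib)
  qed
  show ?thesis
  proof (cases "a / 2 \<in> \<int> \<or> b / 2 \<in> \<int>")
    case True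
    then show ?thesis
      using even[of a b] even[of b a] by (auto simp: parity_sign_def add.commute)
  next
    case False
    then have "(a + 1) / 2 \<in> \<int>" "(b + 1) / 2 \<in> \<int>" using Ints_half_cases assms by blast+
    from Ints_diff[OF Ints_add[OF this] Ints_1] have "(a + b) / 2 \<in> \<int>" by (simp add: add_divide_distrib)
    then show ?thesis using False by (simp add: parity_sign_def)
  qed
qed

text \<open>A Z-basis of E_8: only the last vector involves coordinate 6, with entry 1/2, and the
  others are triangular with diagonal 1, ..., 1, 2, so the determinant is 1 up to sign. Sums over
  subsets stand for the 256 classes modulo 2 E_8.\<close>

definition E8_basis :: "nat \<Rightarrow> real^8" where
  "E8_basis i = (if i < 6 then e8 i + e8 7 else if i = 6 then 2 *\<^sub>R e8 7 else vec8 (\<lambda>k. 1/2))"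

lemma E8_basis_mem: "E8_basis i \<in> E8_lattice"
proof -
  have "1 *\<^sub>R e8 i + 1 *\<^sub>R e8 7 \<in> E8_lattice" if "i < 6" using that by (intro E8_pair_root) auto
  moreover have "1 *\<^sub>R e8 7 + 1 *\<^sub>R e8 7 \<in> E8_lattice" by (intro E8_pair_root) auto
  then have "2 *\<^sub>R e8 7 \<in> E8_lattice" by (simp add: scaleR_2)
  moreover have "vec8 (\<lambda>k. 1/2) \<in> E8_lattice" using E8_spinor_root(1)[of "\<lambda>_. 1"] by simp
  ultimately show ?thesis by (simp add: E8_basis_def)
qed

lemma E8_basis_inner:
  "i < 6 \<Longrightarrow> E8_basis i \<bullet> g = coord g i + coord g 7"
  "E8_basis 6 \<bullet> g = 2 * coord g 7"
  "E8_basis 7 \<bullet> g = (\<Sum>k<8. coord g k) / 2"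
proof -
  show "i < 6 \<Longrightarrow> E8_basis i \<bullet> g = coord g i + coord g 7" "E8_basis 6 \<bullet> g = 2 * coord g 7"
    by (simp_all add: E8_basis_def inner_add_left inner_commute[of "e8 _"] inner_e8)
  show "E8_basis 7 \<bullet> g = (\<Sum>k<8. coord g k) / 2"
    unfolding E8_basis_def inner_coord sum_divide_distrib by (auto intro: sum.cong)
qed

text \<open>This is the self-duality of E_8, or nondegeneracy of the form modulo 2. The parity of
  \<open>coord g 7\<close> decides between the integral and the half-integral type; coordinate 6 is
  recovered from the coordinate sum.\<close>

lemma E8_even_dual:
  assumes g: "g \<in> E8_lattice" and even: "\<And>i. i < 8 \<Longrightarrow> (E8_basis i \<bullet> g) / 2 \<in> \<int>"
  shows "(1/2) *\<^sub>R g \<in> E8_lattice"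
proof -
  have g7: "coord g 7 \<in> \<int>" using even[of 6] by (simp add: E8_basis_inner)
  have i6: "(coord g i + coord g 7) / 2 \<in> \<int>" if "i < 6" for i
    using even[of i] that by (simp add: E8_basis_inner)
  have sum4: "(\<Sum>k<8. coord ((1/2) *\<^sub>R g) k) / 2 \<in> \<int>"
    using even[of 7] by (simp add: E8_basis_inner flip: sum_divide_distrib)
  have sum2: "(\<Sum>k<8. coord g k) / 2 \<in> \<int>" using g by (simp add: mem_E8)
  have less6: "k = 6 \<or> k = 7" if "k < 8" "\<not> k < 6" for k :: nat using that by auto
  show ?thesis
  proof (cases "coord g 7 / 2 \<in> \<int>")
    case True
    have lt: "coord g i / 2 \<in> \<int>" if "i < 6" for i
      using Ints_diff[OF i6[OF that] True] by (simp add: add_divide_distrib)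
    have "coord g 6 / 2 = (\<Sum>k<8. coord g k) / 2 - coord g 0 / 2 - coord g 1 / 2 - coord g 2 / 2
        - coord g 3 / 2 - coord g 4 / 2 - coord g 5 / 2 - coord g 7 / 2"
      unfolding sum_8 by (simp add: add_divide_distrib)
    also have "\<dots> \<in> \<int>" using sum2 lt True by (intro Ints_diff) auto
    finally have "coord ((1/2) *\<^sub>R g) k \<in> \<int>" if "k < 8" for k
      using lt[of k] True less6[OF that] by auto
    then show ?thesis using sum4 unfolding mem_E8 by blast
  next
    case False
    then have h7: "(coord g 7 + 1) / 2 \<in> \<int>" using Ints_half_cases[OF g7] by blast
    have lt: "coord g i / 2 - 1/2 \<in> \<int>" if "i < 6" for i
      using Ints_diff[OF i6[OF that] h7] by (simp add: add_divide_distrib)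
    have h7': "coord g 7 / 2 - 1/2 \<in> \<int>"
      using Ints_diff[OF h7 Ints_1] by (simp add: add_divide_distrib)
    \<comment> \<open>Removing the seven halves leaves an excess of 7/2, which 4 turns into the
      required -1/2.\<close>
    have "coord g 6 / 2 - 1/2 = (\<Sum>k<8. coord g k) / 2 - (coord g 0 / 2 - 1/2) - (coord g 1 / 2 - 1/2)
        - (coord g 2 / 2 - 1/2) - (coord g 3 / 2 - 1/2) - (coord g 4 / 2 - 1/2) - (coord g 5 / 2 - 1/2)
        - (coord g 7 / 2 - 1/2) - 4"
      unfolding sum_8 by (simp add: add_divide_distrib)
    also have "\<dots> \<in> \<int>" 
      by (rule Ints_diff[OF Ints_diff[OF Ints_diff[OF Ints_diff[OF Ints_diff[OF Ints_diff[OF Ints_diff[OF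
        Ints_diff[OF sum2 lt] lt] lt] lt] lt] lt] h7']]) auto
    finally have "coord ((1/2) *\<^sub>R g) k - 1/2 \<in> \<int>" if "k < 8" for k
      using lt[of k] h7' less6[OF that] by auto
    then show ?thesis using sum4 unfolding mem_E8 by blast
  qed
qed

lemma E8_mod_2_representative:
  assumes s: "s \<in> E8_lattice"
  obtains A where "A \<subseteq> {..<8}" "(1/2) *\<^sub>R (s - (\<Sum>i\<in>A. E8_basis i)) \<in> E8_lattice"
proof -
  \<comment> \<open>Coefficients in the basis: coordinate 6 occurs only in the last basis vector and
    fixes \<open>c 7\<close>, the coordinates below 6 fix \<open>c 0\<close> to \<open>c 5\<close>,
    and coordinate 7 leaves \<open>c 6\<close>.\<close>
  define c where "c i = (if i < 6 then coord s i - coord s 6 else if i = 6 then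
    (coord s 7 + 5 * coord s 6 - (\<Sum>k<6. coord s k)) / 2 else 2 * coord s 6)" for i :: nat
  have sum6: "(\<Sum>k<6. coord s k) = coord s 0 + coord s 1 + coord s 2 + coord s 3 + coord s 4 + coord s 5"
    by (simp add: eval_nat_numeral)
  have diff: "coord s i - coord s j \<in> \<int>" if "i < 8" "j < 8" for i j
  proof -
    from s consider "\<forall>k<8. coord s k \<in> \<int>" | "\<forall>k<8. coord s k - 1/2 \<in> \<int>" by (auto simp: mem_E8)
    then show ?thesis
    proof cases
      case 2
      from Ints_diff[OF this[rule_format, OF that(1)] this[rule_format, OF that(2)]]
      show ?thesis by simp
    qed (use that in auto)
  qed
  have "c i \<in> \<int>" if "i < 8" for i
  proof -
    have c6: "c 6 = (\<Sum>k<8. coord s k) / 2 - ((coord s 0 - coord s 6) + (coord s 1 - coord s 6) +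
        (coord s 2 - coord s 6) + (coord s 3 - coord s 6) + (coord s 4 - coord s 6) + (coord s 5 - coord s 6))
        - 2 * (2 * coord s 6)"
      by (simp add: c_def sum6 sum_8 field_simps)
    have two: "2 * coord s 6 \<in> \<int>" using E8.half[OF s] by simp
    have "(coord s 0 - coord s 6) + (coord s 1 - coord s 6) + (coord s 2 - coord s 6) +
        (coord s 3 - coord s 6) + (coord s 4 - coord s 6) + (coord s 5 - coord s 6) \<in> \<int>"
      by (intro Ints_add diff) auto
    moreover have "2 * (2 * coord s 6) \<in> \<int>" by (rule Ints_mult[OF Ints_numeral two])
    moreover have "(\<Sum>k<8. coord s k) / 2 \<in> \<int>" using s by (simp add: mem_E8)
    ultimately have "c 6 \<in> \<int>" unfolding c6 by (blast intro: Ints_diff)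
    moreover have "i < 6 \<or> i = 6 \<or> i = 7" using that by auto
    ultimately show ?thesis using diff two by (auto simp: c_def)
  qed
  note cZ = this
  have s_eq: "s = (\<Sum>i<8. c i *\<^sub>R E8_basis i)"
    unfolding vec8_eq_iff_8 coord_sum sum_8
    by (simp add: E8_basis_def c_def sum6 add_divide_distrib diff_divide_distrib)
  define A where "A = {i. i < 8 \<and> c i / 2 \<notin> \<int>}"
  define d where "d i = (if i \<in> A then (c i - 1) / 2 else c i / 2)" for i
  have dZ: "d i \<in> \<int>" if "i < 8" for i
  proof (cases "i \<in> A")
    case True
    then have "(c i + 1) / 2 \<in> \<int>" using Ints_half_cases[OF cZ[OF that]] by (auto simp: A_def)
    from Ints_diff[OF this Ints_1] show ?thesis using True by (simp add: d_def add_divide_distrib diff_divide_distrib)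
  qed (use that in \<open>auto simp: d_def A_def\<close>)
  have A: "A \<subseteq> {..<8}" by (auto simp: A_def)
  have "(\<Sum>i\<in>A. E8_basis i) = (\<Sum>i<8. if i \<in> A then E8_basis i else 0)"
    using A by (simp add: sum.If_cases Int_absorb1)
  then have "(1/2) *\<^sub>R (s - (\<Sum>i\<in>A. E8_basis i)) =
      (\<Sum>i<8. (1/2) *\<^sub>R (c i *\<^sub>R E8_basis i - (if i \<in> A then E8_basis i else 0)))"
    unfolding scaleR_sum_right[symmetric] sum_subtractf s_eq[symmetric] by simp
  also have "\<dots> = (\<Sum>i<8. d i *\<^sub>R E8_basis i)"
    by (intro sum.cong) (auto simp: d_def scaleR_diff_right diff_divide_distrib scaleR_left_diff_distrib)
  also have "\<dots> \<in> E8_lattice"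
  proof -
    have "(\<Sum>i<n. d i *\<^sub>R E8_basis i) \<in> E8_lattice" if "n \<le> 8" for n
      using that
      by (induction n) (auto simp: E8.zero_mem intro!: E8.add_mem E8.scale_int_mem E8_basis_mem dZ)
    then show ?thesis by simp
  qed
  finally show ?thesis using that A by blast
qed

text \<open>Integrality is carried through the induction since \<open>parity_sign_add\<close> turns
  sums into products only for integers.\<close>

lemma E8_character:
  assumes g: "g \<in> E8_lattice" and A: "finite A"
  shows "parity_sign ((\<Sum>i\<in>A. E8_basis i) \<bullet> g) = (\<Prod>i\<in>A. parity_sign (E8_basis i \<bullet> g))
    \<and> (\<Sum>i\<in>A. E8_basis i) \<bullet> g \<in> \<int>"
  using A
proof (induction A rule: finite_induct)
  case empty
  show ?case by (simp add: parity_sign_def)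
next
  case (insert i A)
  then show ?case
    using E8_inner[OF E8_basis_mem g, of i] by (simp add: inner_add_left parity_sign_add)
qed

text \<open>Orthogonality of characters: the sum over subsets is the expansion of the product of
  \<open>parity_sign (E8_basis i \<bullet> g) + 1\<close>, where a factor vanishes as soon as some
  basis vector pairs oddly with \<open>g\<close>.\<close>

lemma E8_character_sum:
  assumes g: "g \<in> E8_lattice"
  shows "(\<Sum>A\<in>Pow {..<8}. parity_sign ((\<Sum>i\<in>A. E8_basis i) \<bullet> g)) =
    (if (1/2) *\<^sub>R g \<in> E8_lattice then 256 else 0)"
proof -
  have "(\<Sum>A\<in>Pow {..<8}. parity_sign ((\<Sum>i\<in>A. E8_basis i) \<bullet> g)) =
      (\<Sum>A\<in>Pow {..<8}. (\<Prod>i\<in>A. parity_sign (E8_basis i \<bullet> g)) * (\<Prod>i\<in>{..<8} - A. 1))"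
    using E8_character[OF g] by (intro sum.cong) (auto intro: finite_subset)
  also have "\<dots> = (\<Prod>i<8. parity_sign (E8_basis i \<bullet> g) + 1)"
    by (subst prod_add) auto
  also have "\<dots> = (if (1/2) *\<^sub>R g \<in> E8_lattice then 256 else 0)"
  proof (cases "(1/2) *\<^sub>R g \<in> E8_lattice")
    case True
    have "parity_sign (E8_basis i \<bullet> g) = 1" for i
      using E8_inner[OF E8_basis_mem True, of i] by (simp add: parity_sign_def)
    then show ?thesis using True by simp
  next
    case False
    then obtain i where "i < 8" "(E8_basis i \<bullet> g) / 2 \<notin> \<int>" using E8_even_dual[OF g] by blast
    then have "(\<Prod>i<8. parity_sign (E8_basis i \<bullet> g) + 1) = 0"
      by (intro prod_zero) (auto simp: parity_sign_def)
    then show ?thesis using False by simp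
  qed
  finally show ?thesis .
qed

text \<open>Second moment of the character sums: the characters attached to \<open>S\<close> itself are trivial on \<open>S\<close>.\<close>

lemma E8_isotropic_card_le:
  assumes S: "finite S" "S \<subseteq> E8_lattice"
    and iso: "\<And>s t. s \<in> S \<Longrightarrow> t \<in> S \<Longrightarrow> (s \<bullet> t) / 2 \<in> \<int>"
    and distinct: "\<And>s t. s \<in> S \<Longrightarrow> t \<in> S \<Longrightarrow> s \<noteq> t \<Longrightarrow> (1/2) *\<^sub>R (s - t) \<notin> E8_lattice"
  shows "card S \<le> 16"
proof -
  define E where "E A = (\<Sum>i\<in>A. E8_basis i)" for A
  define F where "F A = (\<Sum>t\<in>S. parity_sign (E A \<bullet> t))" for A
  have EZ: "E A \<bullet> t \<in> \<int>" if "A \<in> Pow {..<8}" "t \<in> S" for A t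
    using E8_character[of t A] that S unfolding E_def by (auto intro: finite_subset)
  have "(\<Sum>A\<in>Pow {..<8}. (F A)\<^sup>2) =
      (\<Sum>A\<in>Pow {..<8}. \<Sum>s\<in>S. \<Sum>t\<in>S. parity_sign (E A \<bullet> (s + t)))"
    unfolding F_def power2_eq_square sum_product
    using EZ by (intro sum.cong) (auto simp: inner_add_right parity_sign_add)
  also have "\<dots> = (\<Sum>s\<in>S. \<Sum>t\<in>S. \<Sum>A\<in>Pow {..<8}. parity_sign (E A \<bullet> (s + t)))"
    by (subst sum.swap, intro sum.cong refl, subst sum.swap) simp
  also have "\<dots> = (\<Sum>s\<in>S. \<Sum>t\<in>S. if s = t then 256 else 0)"
  proof (intro sum.cong refl)
    fix s t assume st: "s \<in> S" "t \<in> S"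
    \<comment> \<open>Modulo 2 a sum agrees with a difference, so the pairs that survive are those
      with \<open>s = t\<close>.\<close>
    have "(1/2) *\<^sub>R (s + t) = (1/2) *\<^sub>R (s - t) + t" by (simp add: vec_eq_iff field_simps)
    then have "(1/2) *\<^sub>R (s + t) \<in> E8_lattice \<longleftrightarrow> (1/2) *\<^sub>R (s - t) \<in> E8_lattice"
      using E8.add_mem E8.diff_mem st S(2) by (metis add_diff_cancel_right' subsetD)
    also have "\<dots> \<longleftrightarrow> s = t" using distinct[OF st] E8.zero_mem by auto
    finally have eq: "(1/2) *\<^sub>R (s + t) \<in> E8_lattice \<longleftrightarrow> s = t" .
    have "s + t \<in> E8_lattice" using E8.add_mem st S(2) by blast
    from E8_character_sum[OF this]
    show "(\<Sum>A\<in>Pow {..<8}. parity_sign (E A \<bullet> (s + t))) = (if s = t then 256 else 0)"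
      unfolding E_def eq .
  qed
  also have "\<dots> = 256 * real (card S)" using S(1) by simp
  finally have upper: "(\<Sum>A\<in>Pow {..<8}. (F A)\<^sup>2) = 256 * real (card S)" .
  have "\<exists>A. A \<subseteq> {..<8} \<and> (1/2) *\<^sub>R (s - E A) \<in> E8_lattice" if "s \<in> S" for s
  proof -
    have "s \<in> E8_lattice" using that S(2) by blast
    then obtain A where "A \<subseteq> {..<8}" "(1/2) *\<^sub>R (s - (\<Sum>i\<in>A. E8_basis i)) \<in> E8_lattice"
      by (rule E8_mod_2_representative)
    then show ?thesis unfolding E_def by blast
  qed
  then obtain A where A: "\<And>s. s \<in> S \<Longrightarrow> A s \<subseteq> {..<8}"
      "\<And>s. s \<in> S \<Longrightarrow> (1/2) *\<^sub>R (s - E (A s)) \<in> E8_lattice"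
    by metis
  have inj: "inj_on A S"
  proof (rule inj_onI, rule ccontr)
    fix s t assume st: "s \<in> S" "t \<in> S" "A s = A t" "s \<noteq> t"
    have "(1/2) *\<^sub>R (s - E (A s)) - (1/2) *\<^sub>R (t - E (A t)) \<in> E8_lattice"
      by (intro E8.diff_mem A(2) st)
    then show False using distinct[OF st(1,2,4)] st(3) by (simp flip: scaleR_diff_right)
  qed
  have FA: "F (A s) = real (card S)" if s: "s \<in> S" for s
  proof -
    have "parity_sign (E (A s) \<bullet> t) = 1" if t: "t \<in> S" for t
    proof -
      \<comment> \<open>Replacing \<open>s\<close> by the subset sum of its class changes the inner
        product by an even integer.\<close>
      have "(E (A s) \<bullet> t) / 2 = (s \<bullet> t) / 2 - ((1/2) *\<^sub>R (s - E (A s))) \<bullet> t"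
        by (simp add: inner_diff_left diff_divide_distrib)
      also have "\<dots> \<in> \<int>" using iso[OF s t] A(2)[OF s] t S(2) by (intro Ints_diff E8_inner) auto
      finally show ?thesis by (simp add: parity_sign_def)
    qed
    then show ?thesis by (simp add: F_def)
  qed
  \<comment> \<open>The terms at the subsets of \<open>S\<close> alone contribute the cube of
    \<open>card S\<close>, against a total of 256 times \<open>card S\<close>; 16 is the square root
    of 256.\<close>
  have "real (card S) * (real (card S))\<^sup>2 = (\<Sum>s\<in>S. (F (A s))\<^sup>2)" by (simp add: FA)
  also have "\<dots> = (\<Sum>B\<in>A ` S. (F B)\<^sup>2)" using inj by (simp add: sum.reindex)
  also have "\<dots> \<le> (\<Sum>B\<in>Pow {..<8}. (F B)\<^sup>2)" using A(1) by (intro sum_mono2) auto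
  finally have "real (card S) * (real (card S))\<^sup>2 \<le> real (card S) * 16\<^sup>2" using upper by simp
  then have "card S = 0 \<or> (real (card S))\<^sup>2 \<le> 16\<^sup>2" by (auto simp: mult_le_cancel_left)
  then show ?thesis using power2_le_imp_le[of "real (card S)" 16] by auto
qed

text \<open>Doubled representatives are pairwise orthogonal and inequivalent modulo 2 E_8. The bound
  is proved for finite subsets because finiteness of the code is itself a claim: an infinite code
  would contain 17 points.\<close>

lemma separated_E8_card:
  assumes C: "separated E8_lattice 1 C" and zero: "tcoset E8_lattice 0 \<in> C"
  shows "finite C \<and> card C \<le> 16"
proof -
  have bound: "card F \<le> 16" if F: "F \<subseteq> C" "finite F" for F
  proof -
    have "\<exists>x. p = tcoset E8_lattice x" if "p \<in> F" for p
      using that F C by (auto simp: separated_def torus_def)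
    then obtain x where x: "\<And>p. p \<in> F \<Longrightarrow> p = tcoset E8_lattice (x p)" by metis
    have mem: "tcoset E8_lattice (x p) \<in> C" if "p \<in> F" for p using x that F by auto
    have good: "E8_good (x p)" if "p \<in> F" for p
      using separated_E8_good[OF C mem[OF that] zero] by simp
    have good2: "E8_good (x p - x q)" if "p \<in> F" "q \<in> F" for p q
      using separated_E8_good[OF C mem[OF that(1)] mem[OF that(2)]] .
    let ?f = "\<lambda>p. 2 *\<^sub>R x p"
    have inj: "inj_on ?f F" using x by (intro inj_onI) (metis scaleR_cancel_left zero_neq_numeral)
    have "card (?f ` F) \<le> 16"
    proof (rule E8_isotropic_card_le)
      show "finite (?f ` F)" using F by simp
      show "?f ` F \<subseteq> E8_lattice" using good by (auto simp: E8_good_def)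
      show "(s \<bullet> t) / 2 \<in> \<int>" if "s \<in> ?f ` F" "t \<in> ?f ` F" for s t
        using that E8_good_inner[OF good good good2] by auto
      show "(1/2) *\<^sub>R (s - t) \<notin> E8_lattice" if st: "s \<in> ?f ` F" "t \<in> ?f ` F" "s \<noteq> t" for s t
      proof -
        obtain p q where pq: "p \<in> F" "q \<in> F" "s = ?f p" "t = ?f q" "p \<noteq> q" using st by auto
        then have "x p - x q \<notin> E8_lattice" using x E8.tcoset_eq_iff by metis
        then show ?thesis using pq by (simp flip: scaleR_diff_right)
      qed
    qed
    then show ?thesis using inj by (simp add: card_image)
  qed
  have "finite C"
  proof (rule ccontr)
    assume "infinite C"
    then obtain F where "finite F" "card F = 17" "F \<subseteq> C" using infinite_arbitrarily_large by blast
    then show False using bound[of F] by simp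
  qed
  then show ?thesis using bound[of C] by simp
qed

section \<open>Reflections in roots and the exchange of code points\<close>

definition reflection :: "'a::real_inner \<Rightarrow> 'a \<Rightarrow> 'a" where
  "reflection r x = x - (x \<bullet> r) *\<^sub>R r"

lemma linear_reflection: "linear (reflection r)"
  by (rule linearI) (auto simp: reflection_def inner_add_left algebra_simps)

text \<open>For a root the factor \<open>2 / (r \<bullet> r)\<close> of the usual reflection formula
  is 1, which is why \<open>reflection\<close> contains no quotient.\<close>

lemma reflection_properties:
  assumes "r \<bullet> r = 2"
  shows "reflection r (reflection r x) = x" "norm (reflection r x) = norm x"
proof -
  show "reflection r (reflection r x) = x"
    using assms by (simp add: reflection_def inner_diff_left algebra_simps)
  have "(norm (reflection r x))\<^sup>2 = (norm x)\<^sup>2"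
    using assms by (simp add: power2_norm_eq_inner reflection_def inner_diff_left inner_diff_right
        inner_commute algebra_simps)
  then show "norm (reflection r x) = norm x" by simp
qed

lemma E8_reflection:
  assumes r: "r \<in> E8_lattice" "r \<bullet> r = 2"
  shows "torus_isometry E8_lattice ((`) (reflection r))"
    and "reflection r ` tcoset E8_lattice x = tcoset E8_lattice (reflection r x)"
proof -
  have mem: "reflection r x \<in> E8_lattice" if "x \<in> E8_lattice" for x
    unfolding reflection_def using that r E8_inner by (intro E8.diff_mem E8.scale_int_mem) auto
  have img: "reflection r ` E8_lattice = E8_lattice"
  proof
    show "reflection r ` E8_lattice \<subseteq> E8_lattice" using mem by blast
    show "E8_lattice \<subseteq> reflection r ` E8_lattice"
      using mem reflection_properties(1)[OF r(2)] by (metis image_eqI subsetI)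
  qed
  show "torus_isometry E8_lattice ((`) (reflection r))"
    using linear_reflection reflection_properties(2)[OF r(2)] img by (rule E8.linear_isometry)
  have "reflection r ` tcoset E8_lattice x = (\<lambda>l. reflection r x + l) ` (reflection r ` E8_lattice)"
    unfolding tcoset_def image_image linear_add[OF linear_reflection] ..
  then show "reflection r ` tcoset E8_lattice x = tcoset E8_lattice (reflection r x)"
    unfolding img tcoset_def .
qed

text \<open>Points \<open>u\<close>, \<open>w\<close> at distance less than 1 differ by half a root \<open>r\<close> modulo the lattice; the
  reflection in \<open>r\<close> maps \<open>u\<close> to \<open>w\<close> and fixes every code point at distance 1 from both.\<close>

lemma E8_reflection_step:
  assumes good: "E8_good u" "E8_good w"
    and close: "u - w \<notin> E8_lattice" "\<not> (\<forall>l\<in>E8_lattice. 1 \<le> norm (u - w - l))"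
  obtains \<phi> where "torus_isometry E8_lattice \<phi>" "\<phi> (tcoset E8_lattice u) = tcoset E8_lattice w"
    "\<And>x. E8_good x \<Longrightarrow> E8_good (x - u) \<Longrightarrow> E8_good (x - w) \<Longrightarrow>
      \<phi> (tcoset E8_lattice x) = tcoset E8_lattice x"
proof -
  let ?L = E8_lattice
  obtain l where l: "l \<in> ?L" "norm (u - w - l) < 1" using close(2) by (auto simp: not_le)
  \<comment> \<open>Twice a vector shorter than 1 has squared norm below 4; being a nonzero lattice
    vector, it must be a root.\<close>
  define r where "r = 2 *\<^sub>R (u - w - l)"
  have "r = 2 *\<^sub>R u - 2 *\<^sub>R w - 2 *\<^sub>R l" by (simp add: r_def scaleR_diff_right)
  then have r: "r \<in> ?L"
    using good E8.scale_int_mem[OF l(1), of 2] by (auto simp: E8_good_def intro!: E8.diff_mem)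
  have "r \<noteq> 0" using close(1) l(1) by (auto simp: r_def)
  moreover have "(norm r)\<^sup>2 < 4"
  proof -
    have "(norm (u - w - l))\<^sup>2 < 1" using l(2) by (simp add: abs_square_less_1)
    then show ?thesis by (simp add: r_def power_mult_distrib)
  qed
  ultimately have r2: "r \<bullet> r = 2"
    using E8_norm_ge[OF r] by (auto simp: power2_norm_eq_inner)
  have u: "u = w + (1/2) *\<^sub>R r + l" by (simp add: r_def)
  \<comment> \<open>Both squared norms are integers, so expanding that of \<open>u\<close> forces
    \<open>w \<bullet> r\<close> to be half of an odd integer. The multiple of \<open>r\<close> left
    over in the reflected \<open>u\<close> minus \<open>w\<close> is then integral.\<close>
  have wZ: "w \<bullet> r + 1/2 \<in> \<int>"
  proof -
    have "w \<bullet> r + 1/2 = (norm u)\<^sup>2 - (norm w)\<^sup>2 - 2 * ((norm l)\<^sup>2 / 2) - (2 *\<^sub>R w) \<bullet> l - r \<bullet> l"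
      using r2 unfolding u
      by (simp add: power2_norm_eq_inner inner_add_left inner_add_right inner_commute)
    also have "\<dots> \<in> \<int>"
      using good l r by (intro Ints_diff Ints_mult E8_even E8_inner) (auto simp: E8_good_def)
    finally show ?thesis .
  qed
  have eq: "u \<bullet> r = w \<bullet> r + 1 + l \<bullet> r" unfolding u using r2 by (simp add: inner_add_left)
  show ?thesis
  proof
    show "torus_isometry ?L ((`) (reflection r))" using E8_reflection(1)[OF r r2] .
    have "reflection r u - w = l + (- (w \<bullet> r + 1/2) - l \<bullet> r) *\<^sub>R r"
      unfolding reflection_def eq by (simp add: vec_eq_iff u algebra_simps)
    also have "\<dots> \<in> ?L"
      using wZ l r by (intro E8.add_mem E8.scale_int_mem Ints_diff) (auto simp: E8_inner simp del: minus_add_distrib)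
    finally show "reflection r ` tcoset ?L u = tcoset ?L w"
      unfolding E8_reflection(2)[OF r r2] E8.tcoset_eq_iff .
    \<comment> \<open>The class of \<open>x\<close> is orthogonal to those of \<open>u\<close> and
      \<open>w\<close>, so \<open>x \<bullet> r\<close> is an integer and the reflection moves
      \<open>x\<close> by a lattice vector.\<close>
    fix x assume x: "E8_good x" "E8_good (x - u)" "E8_good (x - w)"
    have "x \<bullet> r = 2 * (x \<bullet> u) - 2 * (x \<bullet> w) - (2 *\<^sub>R x) \<bullet> l"
      by (simp add: r_def inner_diff_right)
    also have "\<dots> \<in> \<int>"
      using x good l by (intro Ints_diff E8_good_inner E8_inner) (auto simp: E8_good_def)
    finally have "reflection r x - x \<in> ?L"
      using E8.uminus_mem[OF E8.scale_int_mem[OF r]] by (simp add: reflection_def)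
    then show "reflection r ` tcoset ?L x = tcoset ?L x"
      unfolding E8_reflection(2)[OF r r2] E8.tcoset_eq_iff .
  qed
qed

lemma E8_embedding_origin:
  assumes "separated E8_lattice 1 C" "separated E8_lattice 1 C'" "finite C" "card C = 16"
    "tcoset E8_lattice 0 \<in> C" "tcoset E8_lattice 0 \<in> C'"
  shows "\<exists>\<phi>. torus_isometry E8_lattice \<phi> \<and> C' \<subseteq> \<phi> ` C"
  using assms
proof (induction "card (C' - C)" arbitrary: C rule: less_induct)
  case (less C)
  let ?L = E8_lattice
  note C = less.prems(1) and C' = less.prems(2) and zero = less.prems(5,6)
  have finC': "finite C'" using separated_E8_card C' zero by blast
  show ?case
  proof (cases "C' \<subseteq> C")
    case True
    then show ?thesis using torus_isometry_id by (intro exI[of _ id]) auto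
  next
    case False
    then obtain p where p: "p \<in> C'" "p \<notin> C" by blast
    obtain w where w: "p = tcoset ?L w" using p C' by (auto simp: separated_def torus_def)
    \<comment> \<open>Sixteen is the maximum, so adding \<open>p\<close> must break separation; this
      yields the point \<open>q\<close> to be exchanged for \<open>p\<close>.\<close>
    have "\<not> separated ?L 1 (insert p C)"
    proof
      assume "separated ?L 1 (insert p C)"
      then have "card (insert p C) \<le> 16" using separated_E8_card zero by blast
      then show False using less.prems(3,4) p by simp
    qed
    moreover have "p \<in> torus ?L" using p C' by (auto simp: separated_def)
    ultimately obtain q where q: "q \<in> C" "\<not> 1 \<le> tdist ?L q p" using separated_insert[OF C] by blast
    obtain u where u: "q \<in> C" "q = tcoset ?L u" using q C by (auto simp: separated_def torus_def)
    have close: "\<not> (\<forall>l\<in>?L. 1 \<le> norm (u - w - l))" using q(2) unfolding u(2) w E8.le_tdist_iff .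
    have uw: "u - w \<notin> ?L" using u p w E8.tcoset_eq_iff by metis
    have "q \<notin> C'"
    proof
      assume "q \<in> C'"
      moreover have "q \<noteq> p" using q p by blast
      ultimately have "1 \<le> tdist ?L q p" using C' p by (simp add: separated_def)
      then show False using q by simp
    qed
    have "E8_good u" "E8_good w"
      using separated_E8_good[OF C, of u 0] separated_E8_good[OF C', of w 0] u p w zero by auto
    then obtain \<phi> where \<phi>: "torus_isometry ?L \<phi>" "\<phi> q = p"
      "\<And>x. E8_good x \<Longrightarrow> E8_good (x - u) \<Longrightarrow> E8_good (x - w) \<Longrightarrow> \<phi> (tcoset ?L x) = tcoset ?L x"
      using E8_reflection_step[OF _ _ uw close] w u(2) by blast
    \<comment> \<open>A common point is orthogonal to \<open>u\<close> through \<open>C\<close> and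
      to \<open>w\<close> through \<open>C'\<close>, the two conditions for being fixed. So
      \<open>p\<close> enters the intersection and nothing leaves it.\<close>
    have fixed: "\<phi> c = c" if c: "c \<in> C" "c \<in> C'" for c
    proof -
      obtain x where x: "c = tcoset ?L x" using c C by (auto simp: separated_def torus_def)
      show ?thesis unfolding x
        using separated_E8_good[OF C, of x 0] separated_E8_good[OF C, of x u]
          separated_E8_good[OF C', of x w] c x u p w zero by (intro \<phi>(3)) auto
    qed
    have sub: "C' - \<phi> ` C \<subseteq> C' - C"
    proof
      fix c assume c: "c \<in> C' - \<phi> ` C"
      then have "c \<notin> C" using fixed by force
      then show "c \<in> C' - C" using c by blast
    qed
    moreover have "p \<in> (C' - C) - (C' - \<phi> ` C)" using p u(1) \<phi>(2) by blast
    ultimately have less: "card (C' - \<phi> ` C) < card (C' - C)"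
      using finC' by (intro psubset_card_mono) auto
    have "inj_on \<phi> (torus ?L)" "C \<subseteq> torus ?L"
      using \<phi>(1) C by (simp_all add: torus_isometry_def bij_betw_def separated_def)
    then have "inj_on \<phi> C" by (rule inj_on_subset)
    then have card: "card (\<phi> ` C) = 16" using less.prems(4) by (simp add: card_image)
    have "\<phi> (tcoset ?L 0) = tcoset ?L 0" using fixed zero by blast
    then have "tcoset ?L 0 \<in> \<phi> ` C" by (metis imageI zero(1))
    then obtain \<psi> where \<psi>: "torus_isometry ?L \<psi>" "C' \<subseteq> \<psi> ` (\<phi> ` C)"
      using less.hyps[OF less separated_isometry[OF \<phi>(1) C] C' finite_imageI[OF less.prems(3)] card _ zero(2)]
      by blast
    then show ?thesis
      using torus_isometry_comp[OF \<psi>(1) \<phi>(1)] by (intro exI[of _ "\<psi> \<circ> \<phi>"]) (simp add: image_comp)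
  qed
qed

lemma dim_E8: "dim E8_lattice = 8"
proof -
  have e: "e8 k \<in> span E8_lattice" if "k < 8" for k
  proof -
    have "(1/2) *\<^sub>R (1 *\<^sub>R e8 k + 1 *\<^sub>R e8 k) \<in> span E8_lattice"
      using that by (intro span_scale span_base E8_pair_root) auto
    then show ?thesis by (simp flip: scaleR_left.add)
  qed
  have "x \<in> span E8_lattice" for x
  proof -
    have "x = (\<Sum>k<8. coord x k *\<^sub>R e8 k)"
      unfolding vec8_eq_iff_8 coord_sum sum_8 by simp
    also have "\<dots> \<in> span E8_lattice" by (intro span_sum span_scale e) auto
    finally show ?thesis .
  qed
  then have "span E8_lattice = UNIV" by blast
  then show ?thesis by (metis dim_span dim_UNIV DIM_cart DIM_real card_bit0 card_num1 mult_1_right numeral_Bit0 mult_2 one_add_one)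
qed

section \<open>Witnesses for E_8\<close>

theorem E8_codes: "lattice_code_optimal_unique E8_lattice"
proof -
  let ?L = E8_lattice
  \<comment> \<open>As for D_4, half a Hadamard matrix on each of the four coordinate pairs, so that
    \<open>T\<close> applied twice is multiplication by 1/2.\<close>
  define T where "T x = lvec [(coord x 0 + coord x 1) / 2, (coord x 0 - coord x 1) / 2,
    (coord x 2 + coord x 3) / 2, (coord x 2 - coord x 3) / 2,
    (coord x 4 + coord x 5) / 2, (coord x 4 - coord x 5) / 2,
    (coord x 6 + coord x 7) / 2, (coord x 6 - coord x 7) / 2]" for x
  have T_coord: "coord (T x) 0 = (coord x 0 + coord x 1) / 2" "coord (T x) (Suc 0) = (coord x 0 - coord x 1) / 2"
    "coord (T x) 2 = (coord x 2 + coord x 3) / 2" "coord (T x) 3 = (coord x 2 - coord x 3) / 2"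
    "coord (T x) 4 = (coord x 4 + coord x 5) / 2" "coord (T x) 5 = (coord x 4 - coord x 5) / 2"
    "coord (T x) 6 = (coord x 6 + coord x 7) / 2" "coord (T x) 7 = (coord x 6 - coord x 7) / 2" for x
    by (simp_all add: T_def)
  have linT: "linear T"
    by (rule linearI) (auto simp: vec8_eq_iff_8 T_coord add_divide_distrib diff_divide_distrib right_diff_distrib distrib_left)
  let ?h = "vec8 (\<lambda>k. 1/2)"
  have h: "?h \<in> ?L" using E8_spinor_root(1)[of "\<lambda>_. 1"] by simp

  \<comment> \<open>Lattice points at distance 1 from the deep hole \<open>e8 0\<close>: the 16
    vertices of a cross-polytope, with \<open>k = 0\<close> giving 0 and
    \<open>2 *\<^sub>R e8 0\<close>. Their mutual distances are at most 2. The seventeenth point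
    \<open>?h\<close> has squared distance 2 from \<open>e8 0\<close>, and a step of a signed unit
    vector from there adds at most 2.\<close>
  define p where "p = (\<lambda>(s::real, k::nat). e8 0 + s *\<^sub>R e8 k)"
  let ?I = "{1, -1} \<times> {..<8::nat}"
  have P: "p ` ?I \<subseteq> ?L"
    using E8_pair_root[of 0 _ 1] by (auto simp: p_def)
  have "inj_on p ?I"
  proof (rule inj_onI)
    fix i j assume ij: "i \<in> ?I" "j \<in> ?I" "p i = p j"
    obtain s k where sk: "i = (s, k)" "s = 1 \<or> s = -1" "k < 8" using ij by auto
    obtain t l where tl: "j = (t, l)" "t = 1 \<or> t = -1" "l < 8" using ij by auto
    have "s *\<^sub>R e8 k = t *\<^sub>R e8 l" using ij(3) by (simp add: p_def sk tl)
    then have "coord (s *\<^sub>R e8 k) k = coord (t *\<^sub>R e8 l) k" by simp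
    then show "i = j" using sk tl by (auto split: if_splits)
  qed
  then have "card (p ` ?I) = 16" by (simp add: card_image)
  moreover have "?h \<notin> p ` ?I"
  proof
    assume "?h \<in> p ` ?I"
    then obtain s k where "?h = e8 0 + s *\<^sub>R e8 k" "s = 1 \<or> s = -1" by (auto simp: p_def)
    then have "coord ?h 0 = coord (e8 0 + s *\<^sub>R e8 k) 0" "s = 1 \<or> s = -1" by simp_all
    then show False by (auto split: if_splits)
  qed
  ultimately have cardP: "card (insert ?h (p ` ?I)) = 17" by simp
  have hp: "(norm (?h - p i))\<^sup>2 \<le> 4" if i: "i \<in> ?I" for i
  proof -
    obtain s k where sk: "i = (s, k)" "s = 1 \<or> s = -1" "k < 8" using i by auto
    let ?v = "?h - e8 0"
    have "(norm ?v)\<^sup>2 = 2" by (simp only: norm_coord_8) (simp add: power2_eq_square)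
    moreover have "(norm (v - s *\<^sub>R e8 k))\<^sup>2 = (norm v)\<^sup>2 - 2 * (s * coord v k) + s\<^sup>2 * (norm (e8 k))\<^sup>2" for v
      unfolding power2_norm_eq_inner inner_e8[OF sk(3), symmetric]
      by (simp add: inner_diff_left inner_diff_right inner_commute power2_eq_square algebra_simps)
    moreover have "(norm (e8 k))\<^sup>2 = 1" using e8_Basis[OF sk(3)] by simp
    moreover have "- (s * coord ?v k) \<le> 1/2" using sk(2,3) by auto
    moreover have "s\<^sup>2 = 1" using sk(2) by auto
    ultimately have "(norm (?v - s *\<^sub>R e8 k))\<^sup>2 \<le> 4" by (simp del: coord_diff)
    then show ?thesis by (simp add: sk(1) p_def diff_diff_eq)
  qed
  have pp: "(norm (p i - p j))\<^sup>2 \<le> 4" if ij: "i \<in> ?I" "j \<in> ?I" for i j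
  proof -
    obtain s k where sk: "i = (s, k)" "s = 1 \<or> s = -1" "k < 8" using ij by auto
    obtain t l where tl: "j = (t, l)" "t = 1 \<or> t = -1" "l < 8" using ij by auto
    have "norm (p i - p j) = norm (s *\<^sub>R e8 k - t *\<^sub>R e8 l)" by (simp add: p_def sk tl)
    also have "\<dots> \<le> norm (s *\<^sub>R e8 k) + norm (t *\<^sub>R e8 l)" by (rule norm_triangle_ineq4)
    also have "\<dots> = 2" using sk tl e8_Basis by auto
    finally have "(norm (p i - p j))\<^sup>2 \<le> 2\<^sup>2" by (intro power_mono) auto
    then show ?thesis by simp
  qed

  \<comment> \<open>The image of the lattice under \<open>T\<close>, modulo the lattice, is a
    four-dimensional space over the field of two elements; the images of these four lattice vectors
    form a basis, and \<open>g\<close> runs over their 16 combinations with coefficients 0 and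
    1.\<close>
  define g where "g = (\<lambda>(a::real, b::real, c::real, d::real).
    a *\<^sub>R (e8 0 + e8 2) + b *\<^sub>R (e8 0 + e8 4) + c *\<^sub>R ?h + d *\<^sub>R (e8 0 + e8 1))"
  let ?B = "{0, 1::real} \<times> {0, 1::real} \<times> {0, 1::real} \<times> {0, 1::real}"
  have g: "g ` ?B \<subseteq> ?L"
  proof -
    have "x *\<^sub>R (e8 0 + e8 j) \<in> ?L" if "x \<in> \<int>" "j < 8" for x j
      using E8.scale_int_mem[OF _ that(1)] E8_pair_root[of 0 j 1 1] that(2) by simp
    then have "g (a, b, c, d) \<in> ?L" if "a \<in> \<int>" "b \<in> \<int>" "c \<in> \<int>" "d \<in> \<int>" for a b c d
      unfolding g_def case_prod_conv using that E8.scale_int_mem[OF h] by (intro E8.add_mem) auto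
    then show ?thesis by auto
  qed
  have g_inj: "i = j" if ij: "i \<in> ?B" "j \<in> ?B" and mem: "T (g i - g j) \<in> ?L" for i j
  proof -
    obtain a b c d where i: "i = (a, b, c, d)" by (metis prod_cases4)
    obtain a' b' c' d' where j: "j = (a', b', c', d')" by (metis prod_cases4)
    define \<alpha> \<beta> \<gamma> \<delta> where "\<alpha> = a - a'" "\<beta> = b - b'" "\<gamma> = c - c'" "\<delta> = d - d'"
    note defs = this
    have small: "\<alpha> \<in> {-1, 0, 1}" "\<beta> \<in> {-1, 0, 1}" "\<gamma> \<in> {-1, 0, 1}" "\<delta> \<in> {-1, 0, 1}"
      using ij by (auto simp: i j defs)
    let ?w = "T (g i - g j)"
    have "g i - g j = g (\<alpha>, \<beta>, \<gamma>, \<delta>)" by (simp add: g_def i j defs algebra_simps)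
    then have w: "coord ?w 0 = (\<alpha> + \<beta> + \<gamma>) / 2 + \<delta>" "coord ?w 1 = (\<alpha> + \<beta>) / 2" "coord ?w 2 = (\<alpha> + \<gamma>) / 2"
      "coord ?w 3 = \<alpha> / 2" "coord ?w 4 = (\<beta> + \<gamma>) / 2" "coord ?w 5 = \<beta> / 2" "coord ?w 6 = \<gamma> / 2" "coord ?w 7 = 0"
      by (simp_all add: T_coord g_def add_divide_distrib)
    \<comment> \<open>Coordinate 7 is 0, which excludes the half-integral type. Coordinates 3, 5 and
      6 then force three coefficients to vanish, and the evenness of the coordinate sum settles
      \<delta>.\<close>
    have "\<not> (\<forall>k<8. coord ?w k - 1/2 \<in> \<int>)"
      unfolding all_less_8 w using half_notin_Ints by simp
    then have int: "\<forall>k<8. coord ?w k \<in> \<int>" using mem unfolding mem_E8 by blast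
    have zero: "t = 0" if "t \<in> {-1, 0, 1}" "t / 2 \<in> \<int>" for t :: real
      using that half_notin_Ints by auto
    have "\<alpha> / 2 \<in> \<int>" "\<beta> / 2 \<in> \<int>" "\<gamma> / 2 \<in> \<int>"
      using int[rule_format, of 3] int[rule_format, of 5] int[rule_format, of 6] unfolding w by simp_all
    then have abc: "\<alpha> = 0" "\<beta> = 0" "\<gamma> = 0" using small zero by blast+
    have "(\<Sum>k<8. coord ?w k) = \<delta>" unfolding sum_8 w by (simp add: abc)
    then have "\<delta> = 0" using mem small(4) zero unfolding mem_E8 by blast
    then show ?thesis using abc by (simp add: i j defs)
  qed
  have "inj_on g ?B"
  proof (rule inj_onI)
    fix i j assume "i \<in> ?B" "j \<in> ?B" "g i = g j"
    then show "i = j" using g_inj[of i j] E8.zero_mem linear_0[OF linT] by simp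
  qed
  then have cardG: "card (g ` ?B) = 16" by (simp add: card_image)
  show ?thesis
  \<comment> \<open>The unit coefficients keep \<open>u\<close> and \<open>v\<close> in the shape of
    \<open>E8_pair_root\<close>; with both indices 0 it yields the vector
    \<open>2 *\<^sub>R e8 0\<close> of the second squared norm 4.\<close>
  proof (rule E8.lattice_code_theorem[where n = 16 and \<rho> = 1 and \<sigma> = 4 and u = "1 *\<^sub>R e8 0 + 1 *\<^sub>R e8 1"
        and v = "1 *\<^sub>R e8 0 + 1 *\<^sub>R e8 0"
        and P = "insert ?h (p ` ?I)" and T = T and s = 2 and G = "g ` ?B"])
    show "2 \<le> (norm z)\<^sup>2" if "z \<in> ?L" "z \<noteq> 0" for z using E8_norm_ge(1)[OF that] .
    show "4 \<le> (norm z)\<^sup>2" if "z \<in> ?L" "z \<noteq> 0" "(norm z)\<^sup>2 \<noteq> 2" for z using E8_norm_ge(2)[OF that] .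
    show "1 *\<^sub>R e8 0 + 1 *\<^sub>R e8 1 \<in> ?L" by (rule E8_pair_root) auto
    show "1 *\<^sub>R e8 0 + 1 *\<^sub>R e8 0 \<in> ?L" by (rule E8_pair_root) auto
    show "(norm (1 *\<^sub>R e8 0 + 1 *\<^sub>R e8 1))\<^sup>2 = 2" by (rule norm_two_e8) auto
    have two: "1 *\<^sub>R e8 0 + 1 *\<^sub>R e8 0 = 2 *\<^sub>R e8 0" by (simp add: scaleR_2)
    show "(norm (1 *\<^sub>R e8 0 + 1 *\<^sub>R e8 0))\<^sup>2 = 4" unfolding two using e8_Basis[of 0] by simp
    show "sqrt (4 / 2) ^ dim ?L = real 16"
      using power_mult[of "sqrt 2" 2 4] by (simp add: dim_E8)
    show "0 < dim ?L" by (simp add: dim_E8)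
    show "(norm y)\<^sup>2 \<le> 1" if "shortest ?L y" for y using E8_shortest(1)[OF that] .
    show "\<exists>\<phi>. torus_isometry ?L \<phi> \<and> C' \<subseteq> \<phi> ` C"
      if C: "separated ?L (sqrt 1) C" "finite C" "card C = 16" "separated ?L (sqrt 1) C'" for C C'
    proof (rule E8.separated_embedding_translate[OF _ C(1,2,3) _ C(4)])
      show "\<exists>\<phi>. torus_isometry ?L \<phi> \<and> C' \<subseteq> \<phi> ` C"
        if "separated ?L (sqrt 1) C" "separated ?L (sqrt 1) C'" "finite C" "card C = 16"
          "tcoset ?L 0 \<in> C" "tcoset ?L 0 \<in> C'" for C C'
        using E8_embedding_origin[of C C'] that by simp
    qed simp
    show "finite C \<and> card C \<le> 16" if "separated ?L (sqrt 1) C" "tcoset ?L 0 \<in> C" for C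
      using separated_E8_card[of C] that by simp
    show "insert ?h (p ` ?I) \<subseteq> ?L" using P h by simp
    show "16 < card (insert ?h (p ` ?I))" using cardP by simp
    show "1 * (norm (x - y))\<^sup>2 \<le> 4" if "x \<in> insert ?h (p ` ?I)" "y \<in> insert ?h (p ` ?I)" for x y
      using that hp pp hp[unfolded norm_minus_commute[of ?h]] by auto
    show "2 * (norm (T x))\<^sup>2 = 1 * (norm x)\<^sup>2" for x
      unfolding norm_coord_8 by (simp add: T_coord) (simp add: power2_eq_square field_simps)
    show "2 *\<^sub>R T l \<in> ?L" if l: "l \<in> ?L" for l
    proof -
      have coords: "coord (2 *\<^sub>R T l) 0 = coord l 0 + coord l 1" "coord (2 *\<^sub>R T l) 1 = coord l 0 - coord l 1"
        "coord (2 *\<^sub>R T l) 2 = coord l 2 + coord l 3" "coord (2 *\<^sub>R T l) 3 = coord l 2 - coord l 3"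
        "coord (2 *\<^sub>R T l) 4 = coord l 4 + coord l 5" "coord (2 *\<^sub>R T l) 5 = coord l 4 - coord l 5"
        "coord (2 *\<^sub>R T l) 6 = coord l 6 + coord l 7" "coord (2 *\<^sub>R T l) 7 = coord l 6 - coord l 7"
        by (simp_all add: T_coord)
      have sum: "(\<Sum>k<8. coord (2 *\<^sub>R T l) k) / 2 = coord l 0 + coord l 2 + coord l 4 + coord l 6"
        unfolding sum_8 coords by simp
      from l consider "\<forall>k<8. coord l k \<in> \<int>" | "\<forall>k<8. coord l k - 1/2 \<in> \<int>" by (auto simp: mem_E8)
      then show ?thesis
      proof cases
        case 1
        then show ?thesis unfolding mem_E8 sum all_less_8 coords by simp
      next
        case 2
        have pm: "x + y \<in> \<int>" "x - y \<in> \<int>" if "x - 1/2 \<in> \<int>" "y - 1/2 \<in> \<int>" for x y :: real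
          using Ints_add[OF Ints_add[OF that] Ints_1] Ints_diff[OF that] by simp_all
        have "(coord l 0 + coord l 2) + (coord l 4 + coord l 6) \<in> \<int>"
          using 2 by (intro Ints_add pm(1)) auto
        then have "(\<Sum>k<8. coord (2 *\<^sub>R T l) k) / 2 \<in> \<int>" unfolding sum by (simp add: add.assoc)
        moreover have "\<forall>k<8. coord (2 *\<^sub>R T l) k \<in> \<int>"
          unfolding all_less_8 coords using 2[unfolded all_less_8] pm[of "coord l 0" "coord l 1"]
            pm[of "coord l 2" "coord l 3"] pm[of "coord l 4" "coord l 5"] pm[of "coord l 6" "coord l 7"]
          by blast
        ultimately show ?thesis unfolding mem_E8 by blast
      qed
    qed
    show "T (2 *\<^sub>R T l) = l" for l
      by (auto simp: T_coord vec8_eq_iff_8 add_divide_distrib diff_divide_distrib)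
    show "x = y" if xy: "x \<in> g ` ?B" "y \<in> g ` ?B" "T (x - y) \<in> ?L" for x y
    proof -
      obtain i where i: "i \<in> ?B" "x = g i" using xy(1) by (rule imageE)
      obtain j where j: "j \<in> ?B" "y = g j" using xy(2) by (rule imageE)
      show ?thesis using g_inj[OF i(1) j(1)] xy(3) unfolding i(2) j(2) by simp
    qed
    show "g ` ?B \<subseteq> ?L" by (rule g)
    show "card (g ` ?B) = 16" by (rule cardG)
    show "linear T" by (rule linT)
  qed simp_all
qed

theorem theorem4p12:
  fixes L :: "(real^8) set"
  assumes "L \<in> {A_lattice 1, A_lattice 2, D4_lattice, E8_lattice}"
  shows "(\<exists>C. lattice_code L C \<and> finite C \<and> real (card C) = n_L L) \<and>
         (\<forall>C. lattice_code L C \<and> finite C \<and> real (card C) = n_L L \<longrightarrow>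
              optimal_code L (card C) C \<and>
              (\<forall>C'. optimal_code L (card C) C' \<longrightarrow>
                    (\<exists>\<phi>. torus_isometry L \<phi> \<and> C' = \<phi> ` C)) \<and>
              (\<forall>C'. optimal_code L (card C - 1) C' \<longrightarrow>
                    (\<exists>\<phi>. torus_isometry L \<phi> \<and> C' \<subseteq> \<phi> ` C)))"
proof -
  have "lattice_code_optimal_unique L"
    using assms A1_codes A2_codes D4_codes E8_codes by blast
  then show ?thesis unfolding lattice_code_optimal_unique_def .
qed

end
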